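(* Let $1<p<\infty$ and let $m\geq 2$ be an integer. There is no linear isometric embedding (norm-preserving complex-linear map) of $S_1^m$ into $S_p$.
   Context: All Banach spaces are complex. For $1\leq p<\infty$, $S_p:=\{T\in B(\ell_2): \mathrm{Tr}(|T|^p)<\infty\}$, where $\ell_2$ is the complex Hilbert space of square-summable sequences, $|T|:=(T^*T)^{1/2}$ and $\mathrm{Tr}$ is the usual trace; it is normed by $\|T\|_p:=(\mathrm{Tr}(|T|^p))^{1/p}$. $S_p^m$ is defined in the same way with $\ell_2$ replaced by $\ell_2^m$ ($\mathbb{C}^m$ with the Euclidean norm); thus $S_1^m$ is the space of complex $m\times m$ matrices with the trace norm $\|T\|_1=\mathrm{Tr}(|T|)$. *)

theory Defs
  imports "HOL-Analysis.Analysis" "HOL-Computational_Algebra.Polynomial"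
begin

text \<open>The Hilbert space of square-summable complex families over an index type:
  \<open>nat ell2\<close> is $\ell_2$, and \<open>'m ell2\<close> for a finite type \<open>'m\<close> is $\ell_2^m$ with \<open>m = CARD('m)\<close>.\<close>

typedef 'i ell2 = "{x :: 'i \<Rightarrow> complex. (\<lambda>i. (cmod (x i))\<^sup>2) summable_on UNIV}"
  morphisms coord Abs_ell2
  by (rule exI[of _ "\<lambda>_. 0"]) simp

setup_lifting type_definition_ell2

lemma square_summable_add:
  fixes x y :: "'i \<Rightarrow> complex"
  assumes "(\<lambda>i. (cmod (x i))\<^sup>2) summable_on UNIV" "(\<lambda>i. (cmod (y i))\<^sup>2) summable_on UNIV"
  shows "(\<lambda>i. (cmod (x i + y i))\<^sup>2) summable_on UNIV"
proof (rule summable_on_comparison_test)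
  show "(\<lambda>i. 2 * (cmod (x i))\<^sup>2 + 2 * (cmod (y i))\<^sup>2) summable_on UNIV"
    by (intro summable_on_add summable_on_cmult_right assms)
  show "(cmod (x i + y i))\<^sup>2 \<le> 2 * (cmod (x i))\<^sup>2 + 2 * (cmod (y i))\<^sup>2" for i
  proof -
    have "(cmod (x i + y i))\<^sup>2 \<le> (cmod (x i) + cmod (y i))\<^sup>2"
      by (intro power_mono norm_triangle_ineq) simp
    also have "\<dots> \<le> 2 * (cmod (x i))\<^sup>2 + 2 * (cmod (y i))\<^sup>2"
      using sum_squares_bound[of "cmod (x i)" "cmod (y i)"] by (simp add: power2_sum)
    finally show ?thesis .
  qed
qed simp

lemma square_summable_scale:
  fixes x :: "'i \<Rightarrow> complex"
  assumes "(\<lambda>i. (cmod (x i))\<^sup>2) summable_on UNIV"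
  shows "(\<lambda>i. (cmod (a * x i))\<^sup>2) summable_on UNIV"
  using summable_on_cmult_right[OF assms, of "(cmod a)\<^sup>2"]
  by (simp add: norm_mult power_mult_distrib)

lemma cinner_summable:
  fixes x y :: "'i ell2"
  shows "(\<lambda>i. cnj (coord x i) * coord y i) summable_on UNIV"
proof (rule abs_summable_summable, rule summable_on_comparison_test)
  show "(\<lambda>i. (cmod (coord x i))\<^sup>2 + (cmod (coord y i))\<^sup>2) summable_on UNIV"
    using coord[of x] coord[of y] by (intro summable_on_add) auto
  show "norm (cnj (coord x i) * coord y i) \<le> (cmod (coord x i))\<^sup>2 + (cmod (coord y i))\<^sup>2" for i
  proof -
    have "2 * (cmod (coord x i) * cmod (coord y i)) \<le> (cmod (coord x i))\<^sup>2 + (cmod (coord y i))\<^sup>2"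
      using sum_squares_bound[of "cmod (coord x i)" "cmod (coord y i)"] by (simp add: mult.assoc)
    moreover have "0 \<le> cmod (coord x i) * cmod (coord y i)" by simp
    ultimately have "cmod (coord x i) * cmod (coord y i) \<le> (cmod (coord x i))\<^sup>2 + (cmod (coord y i))\<^sup>2"
      by linarith
    then show ?thesis by (simp add: norm_mult)
  qed
qed simp

definition cinner :: "'i ell2 \<Rightarrow> 'i ell2 \<Rightarrow> complex" where
  "cinner x y = (\<Sum>\<^sub>\<infinity>i. cnj (coord x i) * coord y i)"

lift_definition cscale :: "complex \<Rightarrow> 'i ell2 \<Rightarrow> 'i ell2" (infixr "*\<^sub>C" 75)
  is "\<lambda>a x i. a * x i"
  by (rule square_summable_scale)

lift_definition basis_vec :: "'i \<Rightarrow> 'i ell2" is "\<lambda>i j. if j = i then 1 else 0"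
proof -
  fix i :: 'i
  show "(\<lambda>j. (cmod (if j = i then 1 else 0))\<^sup>2) summable_on UNIV"
    by (rule finite_nonzero_values_imp_summable_on) simp
qed

instantiation ell2 :: (type) real_vector
begin

lift_definition zero_ell2 :: "'a ell2" is "\<lambda>_. 0" by simp
lift_definition plus_ell2 :: "'a ell2 \<Rightarrow> 'a ell2 \<Rightarrow> 'a ell2" is "\<lambda>x y i. x i + y i"
  by (rule square_summable_add)
lift_definition uminus_ell2 :: "'a ell2 \<Rightarrow> 'a ell2" is "\<lambda>x i. - x i" by simp
lift_definition minus_ell2 :: "'a ell2 \<Rightarrow> 'a ell2 \<Rightarrow> 'a ell2" is "\<lambda>x y i. x i - y i"
proof -
  fix x y :: "'a \<Rightarrow> complex"
  assume "(\<lambda>i. (cmod (x i))\<^sup>2) summable_on UNIV" "(\<lambda>i. (cmod (y i))\<^sup>2) summable_on UNIV"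
  then show "(\<lambda>i. (cmod (x i - y i))\<^sup>2) summable_on UNIV"
    using square_summable_add[of x "\<lambda>i. - y i"] by simp
qed
lift_definition scaleR_ell2 :: "real \<Rightarrow> 'a ell2 \<Rightarrow> 'a ell2" is "\<lambda>r x i. complex_of_real r * x i"
  by (rule square_summable_scale)

instance
proof
  fix x y z :: "'a ell2" and r s :: real
  show "x + y + z = x + (y + z)" "x + y = y + x" "0 + x = x" "- x + x = 0" "x - y = x + - y"
    "scaleR r (x + y) = scaleR r x + scaleR r y" "scaleR (r + s) x = scaleR r x + scaleR s x"
    "scaleR r (scaleR s x) = scaleR (r * s) x" "scaleR 1 x = x"
    by (transfer; simp add: algebra_simps fun_eq_iff)+
qed

end

instantiation ell2 :: (type) real_inner
begin

definition norm_ell2 :: "'a ell2 \<Rightarrow> real" where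
  "norm_ell2 x = sqrt (\<Sum>\<^sub>\<infinity>i. (cmod (coord x i))\<^sup>2)"
definition inner_ell2 :: "'a ell2 \<Rightarrow> 'a ell2 \<Rightarrow> real" where
  "inner_ell2 x y = Re (cinner x y)"
definition sgn_ell2 :: "'a ell2 \<Rightarrow> 'a ell2" where
  "sgn_ell2 x = scaleR (inverse (norm x)) x"
definition dist_ell2 :: "'a ell2 \<Rightarrow> 'a ell2 \<Rightarrow> real" where
  "dist_ell2 x y = norm (x - y)"
definition uniformity_ell2 :: "('a ell2 \<times> 'a ell2) filter" where
  "uniformity_ell2 = (INF e\<in>{0<..}. principal {(x, y). dist x y < e})"
definition open_ell2 :: "'a ell2 set \<Rightarrow> bool" where
  "open_ell2 U = (\<forall>x\<in>U. \<forall>\<^sub>F (x', y) in uniformity. x' = x \<longrightarrow> y \<in> U)"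

instance
proof
  fix x y z :: "'a ell2" and r :: real and U :: "'a ell2 set"
  show "dist x y = norm (x - y)" by (rule dist_ell2_def)
  show "sgn x = x /\<^sub>R norm x" by (rule sgn_ell2_def)
  show "uniformity = (INF e\<in>{0<..}. principal {(x, y). dist (x :: 'a ell2) y < e})"
    by (rule uniformity_ell2_def)
  show "open U = (\<forall>x\<in>U. \<forall>\<^sub>F (x', y) in uniformity. x' = x \<longrightarrow> y \<in> U)"
    by (rule open_ell2_def)
  have cnj_sym: "cinner x y = cnj (cinner y x)"
    unfolding cinner_def infsum_cnj[symmetric] by (simp add: mult.commute)
  then show "inner x y = inner y x"
    by (simp add: inner_ell2_def)
  have "cinner (x + y) z = cinner x z + cinner y z"
    unfolding cinner_def
    by (simp add: plus_ell2.rep_eq distrib_right infsum_add cinner_summable)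
  then show "inner (x + y) z = inner x z + inner y z"
    by (simp add: inner_ell2_def)
  have "cinner (r *\<^sub>R x) y = of_real r * cinner x y"
    unfolding cinner_def
    by (simp add: scaleR_ell2.rep_eq mult.assoc infsum_cmult_right cinner_summable)
  then show "inner (r *\<^sub>R x) y = r * inner x y"
    by (simp add: inner_ell2_def)
  have self: "inner x x = (\<Sum>\<^sub>\<infinity>i. (cmod (coord x i))\<^sup>2)"
  proof -
    have "Re (cinner x x) = (\<Sum>\<^sub>\<infinity>i. Re (cnj (coord x i) * coord x i))"
      unfolding cinner_def
      by (rule infsum_Re[OF cinner_summable, symmetric])
    also have "\<dots> = (\<Sum>\<^sub>\<infinity>i. (cmod (coord x i))\<^sup>2)"
      by (intro infsum_cong) (simp add: cmod_power2, simp add: power2_eq_square)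
    finally show ?thesis
      by (simp add: inner_ell2_def)
  qed
  show "0 \<le> inner x x"
    unfolding self by (rule infsum_nonneg) simp
  show "(inner x x = 0) = (x = 0)"
  proof
    assume "inner x x = 0"
    then have "(cmod (coord x i))\<^sup>2 = 0" for i
      using coord[of x] unfolding self by (intro nonneg_infsum_le_0D[of _ UNIV]) auto
    then show "x = 0"
      by (simp add: coord_inject[symmetric] zero_ell2.rep_eq fun_eq_iff)
  next
    assume "x = 0"
    then show "inner x x = 0"
      unfolding self by (simp add: zero_ell2.rep_eq)
  qed
  show "norm x = sqrt (inner x x)"
    unfolding self norm_ell2_def ..
qed

end

lemma norm_cscale: "norm (a *\<^sub>C x) = cmod a * norm x"
proof -
  have "(\<Sum>\<^sub>\<infinity>i. (cmod (a * coord x i))\<^sup>2) = (cmod a)\<^sup>2 * (\<Sum>\<^sub>\<infinity>i. (cmod (coord x i))\<^sup>2)"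
    using coord[of x]
    by (simp add: norm_mult power_mult_distrib infsum_cmult_right)
  then show ?thesis
    by (simp add: norm_ell2_def cscale.rep_eq real_sqrt_mult)
qed

lemma bounded_linear_cscale: "bounded_linear (\<lambda>x :: 'i ell2. a *\<^sub>C x)"
proof (rule bounded_linear_intro[of _ "cmod a"])
  show "a *\<^sub>C (x + y) = a *\<^sub>C x + a *\<^sub>C y" for x y :: "'i ell2"
    by (transfer) (simp add: distrib_left)
  show "a *\<^sub>C (r *\<^sub>R x) = r *\<^sub>R (a *\<^sub>C x)" for r and x :: "'i ell2"
    by (transfer) (simp add: mult.left_commute)
  show "norm (a *\<^sub>C x) \<le> norm x * cmod a" for x :: "'i ell2"
    by (simp add: norm_cscale mult.commute)
qed

text \<open>The library type \<open>'i ell2 \<Rightarrow>\<^sub>L 'i ell2\<close> consists of the bounded \<^emph>\<open>real\<close>-linear operators, with the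
  operator norm; $B(\ell_2)$ is its subset of complex-linear ones.\<close>

type_synonym 'i op = "'i ell2 \<Rightarrow>\<^sub>L 'i ell2"

definition bounded_ops :: "'i op set" where
  "bounded_ops = {T. \<forall>a x. blinfun_apply T (a *\<^sub>C x) = a *\<^sub>C blinfun_apply T x}"

definition op_cscale :: "complex \<Rightarrow> 'i op \<Rightarrow> 'i op" where
  "op_cscale a T = Blinfun (\<lambda>x. a *\<^sub>C x) o\<^sub>L T"

lemma op_cscale_apply: "blinfun_apply (op_cscale a T) x = a *\<^sub>C blinfun_apply T x"
  by (simp add: op_cscale_def bounded_linear_Blinfun_apply bounded_linear_cscale)

definition adj :: "'i op \<Rightarrow> 'i op" where
  "adj T = (THE S. \<forall>x y. cinner (blinfun_apply S x) y = cinner x (blinfun_apply T y))"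

definition op_poly :: "real poly \<Rightarrow> 'i op \<Rightarrow> 'i op" where
  "op_poly q A = (\<Sum>k\<le>degree q. coeff q k *\<^sub>R (((o\<^sub>L) A ^^ k) id_blinfun))"

text \<open>Real powers \<open>A\<^sup>r\<close>, \<open>r > 0\<close>, of a positive operator \<open>A\<close> by the continuous functional calculus: the
  spectrum of \<open>A\<close> lies in \<open>[0, \<parallel>A\<parallel>]\<close>, and \<open>A\<^sup>r\<close> is the common norm limit of \<open>q\<^sub>n(A)\<close> over all sequences
  of polynomials \<open>q\<^sub>n\<close> tending to \<open>t \<mapsto> t\<^sup>r\<close> uniformly on that interval (note \<open>0 powr r = 0\<close>).
  The value is meaningful only for positive \<open>A\<close> and \<open>r > 0\<close>.\<close>

definition op_powr :: "'i op \<Rightarrow> real \<Rightarrow> 'i op" where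
  "op_powr A r = (THE B. \<forall>q :: nat \<Rightarrow> real poly.
     uniform_limit {0..norm A} (\<lambda>n t. poly (q n) t) (\<lambda>t. t powr r) sequentially \<longrightarrow>
     (\<lambda>n. op_poly (q n) A) \<longlonglongrightarrow> B)"

definition op_abs :: "'i op \<Rightarrow> 'i op" where
  "op_abs T = op_powr (adj T o\<^sub>L T) (1/2)"

text \<open>The trace of a positive operator, with values in \<open>[0, \<infinity>]\<close>. The diagonal entries of a positive
  operator are nonnegative reals, so neither \<open>Re\<close> nor \<open>ennreal\<close> loses information there.\<close>

definition pos_trace :: "'i op \<Rightarrow> ennreal" where
  "pos_trace A = (\<Sum>\<^sub>\<infinity>i. ennreal (Re (cinner (basis_vec i) (blinfun_apply A (basis_vec i)))))"

definition schatten :: "real \<Rightarrow> 'i op set" where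
  "schatten p = {T \<in> bounded_ops. pos_trace (op_powr (op_abs T) p) < \<infinity>}"

definition schatten_norm :: "real \<Rightarrow> 'i op \<Rightarrow> real" where
  "schatten_norm p T = enn2real (pos_trace (op_powr (op_abs T) p)) powr (1/p)"

definition schatten_isometric_embedding :: "real \<Rightarrow> real \<Rightarrow> ('i op \<Rightarrow> 'j op) \<Rightarrow> bool" where
  "schatten_isometric_embedding p q J \<longleftrightarrow>
     (\<forall>T\<in>schatten p. J T \<in> schatten q) \<and>
     (\<forall>S\<in>schatten p. \<forall>T\<in>schatten p. J (S + T) = J S + J T) \<and>
     (\<forall>a. \<forall>T\<in>schatten p. J (op_cscale a T) = op_cscale a (J T)) \<and>
     (\<forall>T\<in>schatten p. schatten_norm q (J T) = schatten_norm p T)"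

end

theory Submission
  imports Defs "HOL-Computational_Algebra.Fundamental_Theorem_Algebra"
begin

text \<open>Already the diagonal copy of $\ell_1^2$ in $S_1^m$ does not embed. The images \<open>A\<close>, \<open>B\<close> of two diagonal
  matrix units would satisfy $\|A\|_p = \|B\|_p = 1$ and $\|A+B\|_p = \|A-B\|_p = 2$. For $p \ge 2$, testing
  on an eigenbasis \<open>e\<close> of $|A+B|^2$ and using Jensen's inequality $\|Te\|^p \le \langle e, |T|^p e\rangle$ forces
  equality in Clarkson's inequality for the vectors $Ae$, $Be$, so that \<open>A = B\<close>. For $p \le 2$ and
  $Z = |A|^2 + |B|^2$, Jensen's inequality on an eigenbasis of \<open>Z\<close> gives
  $\|A+B\|_p^p + \|A-B\|_p^p \le 2\,\mathrm{Tr}(Z^{p/2})$, and Rotfel'd's inequality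
  $\mathrm{Tr}(Z^{p/2}) \le \mathrm{Tr}|A|^p + \mathrm{Tr}|B|^p$ yields $2 \cdot 2^p \le 4$.

  Everything takes place in the real Hilbert space underlying \<open>'i ell2\<close>, so that the library's real inner
  product can be used throughout.\<close>

subsection \<open>Hilbert spaces and compact positive operators\<close>

text \<open>The cases differ because Jensen's inequality reverses at p = 2, where t \<mapsto>
  t^(p/2) turns from convex to concave. For p \<ge> 2 it estimates the vectors Ae and Be from the
  useful side on any basis, so only A + B has to be diagonalised. For p \<le> 2 it does so for A + B
  and A - B, and the parallelogram identity then produces Z = (|A+B|^2 + |A-B|^2)/2. In general
  neither |A|^2 nor |B|^2 is diagonal in an eigenbasis of Z; Rotfel'd's inequality bridges this gap.
  The last estimate says 2^p \<le> 2, which fails exactly for p > 1. Powers of operators are given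
  only as limits of polynomials, and no spectral measure is constructed. Each operator inequality
  therefore comes from a scalar inequality on [0, \<parallel>A\<parallel>] between a polynomial and
  a multiple of t^r (\<open>op_powr_nonneg\<close>); tangents take the place of Jensen's inequality
  for measures. Eigenbases require compactness, which has to be extracted from the finiteness of the
  trace of |T|^p.\<close>

definition orthonormal :: "'a::real_inner set \<Rightarrow> bool" where
  "orthonormal B \<longleftrightarrow> pairwise orthogonal B \<and> (\<forall>b\<in>B. norm b = 1)"

text \<open>Totality is stated as a trivial orthogonal complement because that is what Zorn's lemma
  yields for families of eigenvectors. Convergence of expansions is then a consequence of
  completeness.\<close>

definition orthonormal_basis :: "'a::real_inner set \<Rightarrow> bool" where
  "orthonormal_basis B \<longleftrightarrow> orthonormal B \<and> (\<forall>x. (\<forall>b\<in>B. inner b x = 0) \<longrightarrow> x = 0)"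

lemma orthonormal_inner:
  assumes "orthonormal B" "b \<in> B" "c \<in> B"
  shows "inner b c = (if b = c then 1 else 0)"
  using assms by (auto simp: orthonormal_def pairwise_def orthogonal_def dot_square_norm)

lemma orthonormal_subset: "orthonormal B \<Longrightarrow> C \<subseteq> B \<Longrightarrow> orthonormal C"
  by (auto simp: orthonormal_def intro: pairwise_subset)

lemma orthonormal_norm_sum:
  assumes "orthonormal B" "finite B"
  shows "(norm (\<Sum>b\<in>B. c b *\<^sub>R b))\<^sup>2 = (\<Sum>b\<in>B. (c b)\<^sup>2)"
proof -
  have "(norm (\<Sum>b\<in>B. c b *\<^sub>R b))\<^sup>2 = (\<Sum>b\<in>B. (norm (c b *\<^sub>R b))\<^sup>2)"
    using assms
    by (intro norm_sum_Pythagorean) (auto simp: orthonormal_def pairwise_def orthogonal_def)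
  also have "\<dots> = (\<Sum>b\<in>B. (c b)\<^sup>2)"
    using assms by (intro sum.cong) (auto simp: orthonormal_def)
  finally show ?thesis .
qed

lemma orthonormal_inner_sum:
  assumes "orthonormal B" "finite F" "F \<subseteq> B" "e \<in> B"
  shows "inner e (\<Sum>b\<in>F. c b *\<^sub>R b) = (if e \<in> F then c e else 0)"
proof -
  have "inner e (\<Sum>b\<in>F. c b *\<^sub>R b) = (\<Sum>b\<in>F. if e = b then c b else 0)"
    unfolding inner_sum_right using assms
    by (intro sum.cong) (auto simp: orthonormal_inner subset_iff)
  then show ?thesis using assms(2) by simp
qed

lemma bessel_finite:
  assumes "orthonormal B" "finite B"
  shows "(\<Sum>b\<in>B. (inner b x)\<^sup>2) \<le> (norm x)\<^sup>2"
proof -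
  let ?y = "\<Sum>b\<in>B. inner b x *\<^sub>R b"
  have "inner x ?y = (\<Sum>b\<in>B. (inner b x)\<^sup>2)"
    by (simp add: inner_sum_right power2_eq_square inner_commute)
  moreover have "inner ?y ?y = (\<Sum>b\<in>B. (inner b x)\<^sup>2)"
    using orthonormal_norm_sum[OF assms] by (simp add: dot_square_norm)
  moreover have "inner (x - ?y) (x - ?y) = inner x x - 2 * inner x ?y + inner ?y ?y"
    by (simp only: inner_diff_left inner_diff_right inner_commute[of ?y x])
  moreover have "0 \<le> inner (x - ?y) (x - ?y)" by simp
  ultimately show ?thesis
    by (simp add: dot_square_norm)
qed

lemma bessel_summable:
  assumes "orthonormal B"
  shows "(\<lambda>b. (inner b x)\<^sup>2) summable_on B"
proof (rule nonneg_bdd_above_summable_on)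
  show "bdd_above (sum (\<lambda>b. (inner b x)\<^sup>2) ` {F. F \<subseteq> B \<and> finite F})"
    using bessel_finite[OF orthonormal_subset[OF assms], of _ x]
    by (intro bdd_aboveI[of _ "(norm x)\<^sup>2"]) blast
qed simp

text \<open>By Pythagoras, the squares of the coefficients outside a large finite set control the
  distance between partial sums, so the net of partial sums is Cauchy.\<close>

lemma riesz_fischer:
  fixes B :: "'a::{real_inner,complete_space} set"
  assumes B: "orthonormal B" and c: "(\<lambda>b. (c b)\<^sup>2) summable_on B"
  shows "(\<lambda>b. c b *\<^sub>R b) summable_on B"
proof -
  let ?F = "finite_subsets_at_top B"
  let ?S = "\<lambda>X. \<Sum>b\<in>X. c b *\<^sub>R b"
  have "convergent_filter (filtermap ?S ?F)"
  proof (rule cauchy_filter_convergent, unfold cauchy_filter_metric_filtermap, intro allI impI)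
    fix e :: real assume e: "e > 0"
    obtain s where s: "((\<lambda>b. (c b)\<^sup>2) has_sum s) B" using c by (auto simp: summable_on_def)
    obtain G where G: "finite G" "G \<subseteq> B" "dist (\<Sum>b\<in>G. (c b)\<^sup>2) s \<le> (e/3)\<^sup>2"
      using has_sum_finite_approximation[OF s, of "(e/3)\<^sup>2"] e by auto
    have close: "dist (?S X) (?S G) \<le> e/3" if X: "finite X" "G \<subseteq> X" "X \<subseteq> B" for X
    proof -
      have "(\<Sum>b\<in>X. (c b)\<^sup>2) \<le> s"
        using s X by (intro has_sum_mono_neutral[OF has_sum_finite s]) auto
      moreover have "(\<Sum>b\<in>X. (c b)\<^sup>2) = (\<Sum>b\<in>X-G. (c b)\<^sup>2) + (\<Sum>b\<in>G. (c b)\<^sup>2)"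
        using X by (intro sum.subset_diff) auto
      ultimately have "(\<Sum>b\<in>X-G. (c b)\<^sup>2) \<le> (e/3)\<^sup>2"
        using G(3) by (auto simp: dist_real_def)
      moreover have "?S X - ?S G = ?S (X - G)"
        using X by (subst sum.subset_diff[of G X]) auto
      moreover have "orthonormal (X - G)" "finite (X - G)"
        using X by (auto intro: orthonormal_subset[OF B])
      ultimately have "(norm (?S X - ?S G))\<^sup>2 \<le> (e/3)\<^sup>2"
        by (simp add: orthonormal_norm_sum)
      then show ?thesis
        using e by (simp add: dist_norm abs_le_square_iff[symmetric])
    qed
    show "\<exists>P. eventually P ?F \<and> (\<forall>x y. P x \<and> P y \<longrightarrow> dist (?S x) (?S y) < e)"
    proof (intro exI conjI allI impI)
      show "\<forall>\<^sub>F X in ?F. finite X \<and> G \<subseteq> X \<and> X \<subseteq> B"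
        using G unfolding eventually_finite_subsets_at_top by blast
      fix X Y assume "(finite X \<and> G \<subseteq> X \<and> X \<subseteq> B) \<and> (finite Y \<and> G \<subseteq> Y \<and> Y \<subseteq> B)"
      then have "dist (?S X) (?S G) \<le> e/3" "dist (?S Y) (?S G) \<le> e/3"
        using close by auto
      then show "dist (?S X) (?S Y) < e"
        using dist_triangle2[of "?S X" "?S Y" "?S G"] e by linarith
    qed
  qed
  then show ?thesis
    by (simp add: summable_on_def has_sum_def convergent_filter_iff filterlim_def)
qed

lemma orthonormal_basis_expansion:
  fixes B :: "'a::{real_inner,complete_space} set"
  assumes B: "orthonormal_basis B"
  shows "((\<lambda>b. inner b x *\<^sub>R b) has_sum x) B"
proof -
  have on: "orthonormal B" using B by (simp add: orthonormal_basis_def)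
  obtain y where y: "((\<lambda>b. inner b x *\<^sub>R b) has_sum y) B"
    using riesz_fischer[OF on bessel_summable[OF on]] by (auto simp: summable_on_def)
  have "inner e (x - y) = 0" if e: "e \<in> B" for e
  proof -
    have "((\<lambda>b. inner e (inner b x *\<^sub>R b)) has_sum inner e y) B"
      by (rule has_sum_bounded_linear[OF bounded_linear_inner_right y])
    \<comment> \<open>Orthonormality leaves only the term at \<open>e\<close>, so the sum reduces to
      one over \<open>{e}\<close>.\<close>
    moreover have "((\<lambda>b. inner e (inner b x *\<^sub>R b)) has_sum inner e x) B"
      using e on
      by (intro has_sum_finiteI[of "{e}", THEN has_sum_cong_neutral[THEN iffD1, rotated -1]])
         (auto simp: orthonormal_inner)
    ultimately show ?thesis
      using has_sum_unique by (fastforce simp: inner_diff_right)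
  qed
  then have "x - y = 0" using B unfolding orthonormal_basis_def by blast
  with y show ?thesis by simp
qed

lemma has_sum_inner_basis:
  fixes B :: "'a::{real_inner,complete_space} set"
  assumes "orthonormal_basis B"
  shows "((\<lambda>b. inner b x * inner b y) has_sum inner x y) B"
  using has_sum_bounded_linear[OF bounded_linear_inner_left orthonormal_basis_expansion[OF assms], of y x]
  by (simp add: inner_commute[of y] mult.commute)

lemma parseval:
  fixes B :: "'a::{real_inner,complete_space} set"
  assumes "orthonormal_basis B"
  shows "((\<lambda>b. (inner b x)\<^sup>2) has_sum (norm x)\<^sup>2) B"
  using has_sum_inner_basis[OF assms, of x x] by (simp add: power2_eq_square dot_square_norm)

text \<open>The coefficients of \<open>S y\<close> are forced to be \<open>inner (T b) y\<close>.
  They are square-summable: evaluating T at the vector with these same coefficients bounds their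
  square sum s by \<parallel>T\<parallel> \<parallel>y\<parallel> sqrt s. Existence is needed
  because \<open>adj\<close> is a definite description.\<close>

lemma adjoint_exists:
  fixes T :: "'a::{real_inner,complete_space} \<Rightarrow>\<^sub>L 'a"
  assumes B: "orthonormal_basis (B :: 'a set)"
  shows "\<exists>S :: 'a \<Rightarrow>\<^sub>L 'a. \<forall>x y. inner (S x) y = inner x (T y)"
proof -
  have on: "orthonormal B" using B by (simp add: orthonormal_basis_def)
  have bd: "(\<Sum>b\<in>F. (inner (T b) y)\<^sup>2) \<le> (norm T * norm y)\<^sup>2" if F: "finite F" "F \<subseteq> B" for F y
  proof -
    let ?v = "\<Sum>b\<in>F. inner (T b) y *\<^sub>R b"
    let ?s = "\<Sum>b\<in>F. (inner (T b) y)\<^sup>2"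
    have nv: "(norm ?v)\<^sup>2 = ?s"
      using F on by (intro orthonormal_norm_sum) (auto intro: orthonormal_subset)
    have "?s = inner (T ?v) y"
      by (simp add: blinfun.sum_right blinfun.scaleR_right inner_sum_left power2_eq_square)
    also have "\<dots> \<le> norm (T ?v) * norm y" by (rule norm_cauchy_schwarz)
    also have "\<dots> \<le> norm T * norm ?v * norm y"
      by (intro mult_right_mono norm_blinfun) simp
    finally have "norm ?v * norm ?v \<le> (norm T * norm y) * norm ?v"
      using nv by (simp add: power2_eq_square mult_ac)
    then have "norm ?v \<le> norm T * norm y"
      by (cases "norm ?v = 0") (auto simp: mult_le_cancel_right)
    then show ?thesis unfolding nv[symmetric] by (rule power_mono) simp
  qed
  have "(\<lambda>b. (inner (T b) y)\<^sup>2) summable_on B" for y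
    using bd by (intro nonneg_bdd_above_summable_on bdd_aboveI[of _ "(norm T * norm y)\<^sup>2"]) auto
  then have "\<forall>y. \<exists>s. ((\<lambda>b. inner (T b) y *\<^sub>R b) has_sum s) B"
    using riesz_fischer[OF on] by (auto simp: summable_on_def)
  then obtain S where S: "\<And>y. ((\<lambda>b. inner (T b) y *\<^sub>R b) has_sum S y) B" by metis
  have adj: "inner (S y) x = inner y (T x)" for x y
  proof -
    have "((\<lambda>b. inner (inner (T b) y *\<^sub>R b) x) has_sum inner (S y) x) B"
      by (rule has_sum_bounded_linear[OF bounded_linear_inner_left S])
    moreover have "((\<lambda>b. inner y (T (inner b x *\<^sub>R b))) has_sum inner y (T x)) B"
      by (intro has_sum_bounded_linear[OF bounded_linear_inner_right]
          has_sum_bounded_linear[OF blinfun.bounded_linear_right] orthonormal_basis_expansion B)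
    then have "((\<lambda>b. inner (inner (T b) y *\<^sub>R b) x) has_sum inner y (T x)) B"
      by (simp add: blinfun.scaleR_right inner_commute mult.commute)
    ultimately show ?thesis by (rule has_sum_unique)
  qed
  have "bounded_linear S"
  proof (rule bounded_linear_intro[of _ "norm T"])
    show "S (x + y) = S x + S y" for x y
      by (rule vector_eq_ldot[THEN iffD1]) (simp add: adj inner_add_right inner_commute[of _ "S _"] inner_add_left)
    show "S (r *\<^sub>R x) = r *\<^sub>R S x" for r x
      by (rule vector_eq_ldot[THEN iffD1]) (simp add: adj inner_commute[of _ "S _"])
    show "norm (S x) \<le> norm x * norm T" for x
    proof -
      have "norm (S x) * norm (S x) = inner x (T (S x))"
        using adj[of x "S x"] by (simp add: dot_square_norm power2_eq_square)
      also have "\<dots> \<le> norm x * (norm T * norm (S x))"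
        by (rule order_trans[OF norm_cauchy_schwarz]) (simp add: mult_left_mono norm_blinfun)
      finally show ?thesis
        by (cases "norm (S x) = 0") (auto simp: mult.assoc[symmetric] mult_le_cancel_right)
    qed
  qed
  then have "\<forall>x y. inner (Blinfun S x) y = inner x (T y)"
    by (simp add: bounded_linear_Blinfun_apply adj)
  then show ?thesis by blast
qed


text \<open>Symmetry is demanded separately, since over the reals a nonnegative quadratic form does
  not imply it.\<close>

definition positive_op :: "('a::real_inner \<Rightarrow>\<^sub>L 'a) \<Rightarrow> bool" where
  "positive_op A \<longleftrightarrow> (\<forall>x y. inner (A x) y = inner x (A y)) \<and> (\<forall>x. 0 \<le> inner x (A x))"

lemma positive_op_symmetric: "positive_op A \<Longrightarrow> inner (A x) y = inner x (A y)"
  by (simp add: positive_op_def)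

lemma positive_op_nonneg: "positive_op A \<Longrightarrow> 0 \<le> inner x (A x)"
  by (simp add: positive_op_def)

text \<open>Evaluate the form at x - t A x with t = 1/\<parallel>A\<parallel>, where the quadratic
  term in t cancels at most half of the linear one. Nonnegativity is assumed along this line only,
  so that the lemma also serves operators that are nonnegative merely on an invariant
  subspace.\<close>

lemma norm_square_le_quadratic_form:
  fixes A :: "'a::real_inner \<Rightarrow>\<^sub>L 'a"
  assumes sym: "\<And>x y. inner (A x) y = inner x (A y)"
    and nonneg: "\<And>t. 0 \<le> inner (x - t *\<^sub>R A x) (A (x - t *\<^sub>R A x))"
  shows "(norm (A x))\<^sup>2 \<le> norm A * inner x (A x)"
proof (cases "A = 0")
  case False
  define t where "t = 1 / norm A"
  have t: "t > 0" "t * norm A = 1" using False by (auto simp: t_def)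
  have "inner (x - t *\<^sub>R A x) (A (x - t *\<^sub>R A x))
      = inner x (A x) - 2 * t * (norm (A x))\<^sup>2 + t\<^sup>2 * inner (A x) (A (A x))"
    by (simp add: blinfun.diff_right blinfun.scaleR_right inner_diff_left inner_diff_right
        sym[of x "A x", symmetric] dot_square_norm power2_eq_square algebra_simps)
  moreover have "inner (A x) (A (A x)) \<le> norm (A x) * (norm A * norm (A x))"
    by (rule order_trans[OF norm_cauchy_schwarz]) (simp add: mult_left_mono norm_blinfun)
  then have "t\<^sup>2 * inner (A x) (A (A x)) \<le> t\<^sup>2 * (norm (A x) * (norm A * norm (A x)))"
    by (intro mult_left_mono) auto
  moreover have "t\<^sup>2 * (norm (A x) * (norm A * norm (A x))) = t * (t * norm A) * (norm (A x))\<^sup>2"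
    by (simp add: power2_eq_square)
  ultimately have "t * (norm (A x))\<^sup>2 \<le> inner x (A x)"
    using nonneg[of t] t by simp
  then have "norm A * (t * (norm (A x))\<^sup>2) \<le> norm A * inner x (A x)"
    by (intro mult_left_mono) auto
  then show ?thesis using t by (simp add: mult.assoc[symmetric] mult.commute)
qed simp

lemma positive_op_norm_square_le:
  "positive_op A \<Longrightarrow> (norm (A x))\<^sup>2 \<le> norm A * inner x (A x)"
  by (intro norm_square_le_quadratic_form) (auto simp: positive_op_def)

text \<open>For operators between Hilbert spaces this is equivalent to compactness; the estimate is stable
  under sums and domination and is all that the existence of eigenvectors needs.\<close>

definition compact_op :: "('a::real_inner \<Rightarrow>\<^sub>L 'a) \<Rightarrow> bool" where
  "compact_op A \<longleftrightarrow> (\<forall>\<epsilon>>0. \<exists>F C. finite F \<and>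
     (\<forall>x. norm (A x) \<le> \<epsilon> * norm x + C * (\<Sum>f\<in>F. \<bar>inner f x\<bar>)))"

text \<open>Outside a finite set G the squares of the norms of \<open>Q b\<close> sum to at most
  \<epsilon>^2, so Cauchy-Schwarz and Bessel give the \<epsilon> part; the rest sees x only through
  its coefficients on G.\<close>

lemma hilbert_schmidt_compact:
  fixes Q :: "'a::{real_inner,complete_space} \<Rightarrow>\<^sub>L 'a"
  assumes B: "orthonormal_basis B" and Q: "(\<lambda>b. (norm (Q b))\<^sup>2) summable_on B"
  shows "compact_op Q"
  unfolding compact_op_def
proof (intro allI impI)
  fix \<epsilon> :: real assume \<epsilon>: "\<epsilon> > 0"
  have on: "orthonormal B" using B by (simp add: orthonormal_basis_def)
  obtain s where s: "((\<lambda>b. (norm (Q b))\<^sup>2) has_sum s) B" using Q by (auto simp: summable_on_def)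
  obtain G where G: "finite G" "G \<subseteq> B" "dist (\<Sum>b\<in>G. (norm (Q b))\<^sup>2) s \<le> \<epsilon>\<^sup>2"
    using has_sum_finite_approximation[OF s, of "\<epsilon>\<^sup>2"] \<epsilon> by auto
  define C where "C = (\<Sum>b\<in>G. norm (Q b))"
  have "norm (Q x) \<le> \<epsilon> * norm x + C * (\<Sum>f\<in>G. \<bar>inner f x\<bar>)" for x
  proof -
    have "((\<lambda>b. Q (inner b x *\<^sub>R b)) has_sum Q x) B"
      by (intro has_sum_bounded_linear[OF blinfun.bounded_linear_right] orthonormal_basis_expansion B)
    then have lim: "((\<lambda>X. \<Sum>b\<in>X. inner b x *\<^sub>R Q b) \<longlongrightarrow> Q x) (finite_subsets_at_top B)"
      by (simp add: has_sum_def blinfun.scaleR_right)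
    have "norm (\<Sum>b\<in>X. inner b x *\<^sub>R Q b) \<le> \<epsilon> * norm x + C * (\<Sum>f\<in>G. \<bar>inner f x\<bar>)"
      if X: "finite X" "G \<subseteq> X" "X \<subseteq> B" for X
    proof -
      have "(\<Sum>b\<in>X. (norm (Q b))\<^sup>2) \<le> s"
        using s X by (intro has_sum_mono_neutral[OF has_sum_finite s]) auto
      moreover have "(\<Sum>b\<in>X. (norm (Q b))\<^sup>2) = (\<Sum>b\<in>X-G. (norm (Q b))\<^sup>2) + (\<Sum>b\<in>G. (norm (Q b))\<^sup>2)"
        using X by (intro sum.subset_diff) auto
      ultimately have tail: "(\<Sum>b\<in>X-G. (norm (Q b))\<^sup>2) \<le> \<epsilon>\<^sup>2"
        using G(3) by (auto simp: dist_real_def)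
      have bes: "(\<Sum>b\<in>X-G. (inner b x)\<^sup>2) \<le> (norm x)\<^sup>2"
        using X by (intro bessel_finite orthonormal_subset[OF on]) auto
      have "(\<Sum>b\<in>X-G. \<bar>inner b x\<bar> * norm (Q b)) \<le> L2_set (\<lambda>b. inner b x) (X-G) * L2_set (\<lambda>b. norm (Q b)) (X-G)"
        using L2_set_mult_ineq[of "\<lambda>b. inner b x" "\<lambda>b. norm (Q b)" "X - G"] by simp
      also have "\<dots> \<le> norm x * \<epsilon>"
        unfolding L2_set_def using tail bes \<epsilon>
        by (intro mult_mono real_le_lsqrt) (auto intro: sum_nonneg)
      finally have 1: "(\<Sum>b\<in>X-G. \<bar>inner b x\<bar> * norm (Q b)) \<le> \<epsilon> * norm x" by (simp add: mult.commute)
      have "(\<Sum>b\<in>G. \<bar>inner b x\<bar> * norm (Q b)) \<le> (\<Sum>b\<in>G. \<bar>inner b x\<bar> * C)"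
        unfolding C_def using G(1) by (intro sum_mono mult_left_mono member_le_sum) auto
      then have 2: "(\<Sum>b\<in>G. \<bar>inner b x\<bar> * norm (Q b)) \<le> C * (\<Sum>f\<in>G. \<bar>inner f x\<bar>)"
        by (simp add: sum_distrib_left mult.commute)
      have "norm (\<Sum>b\<in>X. inner b x *\<^sub>R Q b) \<le> (\<Sum>b\<in>X. \<bar>inner b x\<bar> * norm (Q b))"
        by (rule order_trans[OF norm_sum]) simp
      also have "\<dots> = (\<Sum>b\<in>X-G. \<bar>inner b x\<bar> * norm (Q b)) + (\<Sum>b\<in>G. \<bar>inner b x\<bar> * norm (Q b))"
        using X by (intro sum.subset_diff) auto
      finally show ?thesis using 1 2 by linarith
    qed
    then have "\<forall>\<^sub>F X in finite_subsets_at_top B.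
        norm (\<Sum>b\<in>X. inner b x *\<^sub>R Q b) \<le> \<epsilon> * norm x + C * (\<Sum>f\<in>G. \<bar>inner f x\<bar>)"
      using G unfolding eventually_finite_subsets_at_top by blast
    then show ?thesis
      by (intro tendsto_upperbound[OF tendsto_norm[OF lim]]) auto
  qed
  then show "\<exists>F C. finite F \<and> (\<forall>x. norm (Q x) \<le> \<epsilon> * norm x + C * (\<Sum>f\<in>F. \<bar>inner f x\<bar>))"
    using G(1) by blast
qed

lemma simultaneous_convergent_subsequence:
  fixes g :: "'b \<Rightarrow> nat \<Rightarrow> real"
  assumes "finite F" "\<And>f. f \<in> F \<Longrightarrow> bounded (range (g f))"
  shows "\<exists>s. strict_mono (s :: nat \<Rightarrow> nat) \<and> (\<forall>f\<in>F. convergent (g f \<circ> s))"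
  using assms
proof (induction F rule: finite_induct)
  case empty
  then show ?case by (auto intro: strict_mono_id)
next
  case (insert f F)
  then obtain s where s: "strict_mono (s :: nat \<Rightarrow> nat)" "\<forall>f\<in>F. convergent (g f \<circ> s)"
    by (metis insertCI)
  have "bounded (range (g f \<circ> s))"
    by (rule bounded_subset[of "range (g f)"]) (use insert.prems in auto)
  then obtain l r where r: "strict_mono (r :: nat \<Rightarrow> nat)" "(g f \<circ> s \<circ> r) \<longlonglongrightarrow> l"
    using bounded_imp_convergent_subsequence by blast
  have "convergent (g h \<circ> (s \<circ> r))" if "h \<in> insert f F" for h
    using that r s(2) convergent_subseq_convergent[OF _ r(1), of "g h \<circ> s"]
    by (auto simp: convergent_def comp_assoc)
  then show ?case using s(1) r(1) strict_mono_o by blast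
qed

text \<open>The quadratic form is maximised over unit vectors of the orthogonal complement V of E,
  which X leaves invariant. If the supremum is 0, then X vanishes on V; otherwise a maximising
  sequence consists of approximate eigenvectors, and compactness provides a convergent
  subsequence.\<close>

lemma compact_op_eigenvector:
  fixes X :: "'a::{real_inner,complete_space} \<Rightarrow>\<^sub>L 'a"
  assumes X: "positive_op X" "compact_op X"
    and E: "\<And>e. e \<in> E \<Longrightarrow> \<exists>\<mu>. X e = \<mu> *\<^sub>R e"
    and u: "u \<noteq> 0" "\<forall>e\<in>E. inner e u = 0"
  shows "\<exists>v \<mu>. norm v = 1 \<and> (\<forall>e\<in>E. inner e v = 0) \<and> X v = \<mu> *\<^sub>R v"
proof -
  define V where "V = {v. \<forall>e\<in>E. inner e v = 0}"
  have VX: "X v \<in> V" if "v \<in> V" for v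
  proof -
    have "inner e (X v) = 0" if e: "e \<in> E" for e
    proof -
      obtain l where "X e = l *\<^sub>R e" using E e by blast
      then show ?thesis
        using \<open>v \<in> V\<close> e positive_op_symmetric[OF X(1), of e v] by (simp add: V_def)
    qed
    then show ?thesis by (simp add: V_def)
  qed
  have V_diff: "v - t *\<^sub>R w \<in> V" if "v \<in> V" "w \<in> V" for v w t
    using that by (simp add: V_def inner_diff_right)
  have V_scale: "t *\<^sub>R v \<in> V" if "v \<in> V" for v t
    using that by (simp add: V_def)
  define Q where "Q = {inner v (X v) |v. v \<in> V \<and> norm v = 1}"
  define \<mu> where "\<mu> = Sup Q"
  have u1: "sgn u \<in> V" "norm (sgn u) = 1"
    using u by (auto simp: V_def sgn_div_norm)
  then have Qne: "Q \<noteq> {}" by (auto simp: Q_def)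
  have "inner v (X v) \<le> norm X" if "norm v = 1" for v
    using norm_cauchy_schwarz[of v "X v"] norm_blinfun[of X v] that by simp
  then have bdd: "bdd_above Q" by (auto simp: Q_def intro!: bdd_aboveI)
  have le\<mu>: "inner v (X v) \<le> \<mu>" if "v \<in> V" "norm v = 1" for v
    unfolding \<mu>_def using that bdd by (intro cSup_upper) (auto simp: Q_def)
  have form: "inner v (X v) \<le> \<mu> * (norm v)\<^sup>2" if "v \<in> V" for v
  proof (cases "v = 0")
    case False
    have "inner (sgn v) (X (sgn v)) \<le> \<mu>"
      using that False by (intro le\<mu>) (auto simp: sgn_div_norm V_scale)
    then show ?thesis
      using False by (simp add: sgn_div_norm blinfun.scaleR_right field_simps power2_eq_square)
  qed simp
  have \<mu>0: "\<mu> \<ge> 0"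
    using le\<mu>[OF u1] positive_op_nonneg[OF X(1), of "sgn u"] by linarith
  show ?thesis
  proof (cases "\<mu> = 0")
    case True
    then have "inner (sgn u) (X (sgn u)) = 0"
      using le\<mu>[OF u1] positive_op_nonneg[OF X(1), of "sgn u"] by linarith
    then have "X (sgn u) = 0 *\<^sub>R sgn u"
      using positive_op_norm_square_le[OF X(1), of "sgn u"] by simp
    then show ?thesis using u1 unfolding V_def by blast
  next
    case False
    then have \<mu>: "\<mu> > 0" using \<mu>0 by simp
    have "\<exists>v. v \<in> V \<and> norm v = 1 \<and> \<mu> - 1 / real (Suc n) < inner v (X v)" for n
      using less_cSup_iff[OF Qne bdd, of "\<mu> - 1 / real (Suc n)"] by (auto simp: \<mu>_def Q_def)
    then obtain v where v: "\<And>n. v n \<in> V" "\<And>n. norm (v n) = 1"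
      "\<And>n. \<mu> - 1 / real (Suc n) < inner (v n) (X (v n))" by metis
    \<comment> \<open>D is nonnegative on V, not necessarily elsewhere. Its quadratic form tends to
      0 along the maximising sequence, hence so does \<open>D (v n)\<close>.\<close>
    define D where "D = \<mu> *\<^sub>R id_blinfun - X"
    have D: "D x = \<mu> *\<^sub>R x - X x" for x
      by (simp add: D_def blinfun.diff_left blinfun.scaleR_left)
    have Dle: "(norm (D (v n)))\<^sup>2 \<le> norm D * (1 / real (Suc n))" for n
    proof -
      have "(norm (D (v n)))\<^sup>2 \<le> norm D * inner (v n) (D (v n))"
      proof (rule norm_square_le_quadratic_form)
        show "inner (D x) y = inner x (D y)" for x y
          by (simp add: D inner_diff positive_op_symmetric[OF X(1)])
        fix t
        let ?w = "v n - t *\<^sub>R D (v n)"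
        have "?w \<in> V"
          unfolding D using v(1)[of n] V_diff[of "\<mu> *\<^sub>R v n" "X (v n)" 1]
          by (intro V_diff) (auto simp: V_scale VX)
        then show "0 \<le> inner ?w (D ?w)"
          using form by (simp add: D inner_diff_right dot_square_norm)
      qed
      also have "\<dots> \<le> norm D * (1 / real (Suc n))"
        using v(2,3)[of n] by (intro mult_left_mono) (auto simp: D inner_diff_right dot_square_norm)
      finally show ?thesis .
    qed
    have "(\<lambda>n. norm D * (1 / real (Suc n))) \<longlonglongrightarrow> norm D * 0"
      by (intro tendsto_intros LIMSEQ_Suc[OF lim_1_over_n])
    then have "(\<lambda>n. norm D * (1 / real (Suc n))) \<longlonglongrightarrow> 0" by simp
    then have "(\<lambda>n. (norm (D (v n)))\<^sup>2) \<longlonglongrightarrow> 0"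
      by (rule Lim_null_comparison[rotated]) (use Dle in simp)
    then have r: "(\<lambda>n. norm (D (v n))) \<longlonglongrightarrow> 0"
      using tendsto_real_sqrt by fastforce
    \<comment> \<open>The error constant \<mu>/2 can be absorbed by the left-hand side in
      \<open>hb\<close>, leaving half of \<mu> times the distance.\<close>
    obtain F C where F: "finite F" "\<And>x. norm (X x) \<le> \<mu>/2 * norm x + C * (\<Sum>f\<in>F. \<bar>inner f x\<bar>)"
      using X(2) half_gt_zero[OF \<mu>] unfolding compact_op_def by blast
    have "bounded (range (\<lambda>n. inner f (v n)))" for f
      unfolding bounded_iff using Cauchy_Schwarz_ineq2[of f "v _"] v(2)
      by (intro exI[of _ "norm f"]) simp
    then obtain s where s: "strict_mono s" "\<And>f. f \<in> F \<Longrightarrow> convergent ((\<lambda>n. inner f (v n)) \<circ> s)"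
      using simultaneous_convergent_subsequence[OF F(1), of "\<lambda>f n. inner f (v n)"] by auto
    define w where "w = v \<circ> s"
    have rw: "(\<lambda>n. norm (D (w n))) \<longlonglongrightarrow> 0"
      using LIMSEQ_subseq_LIMSEQ[OF r s(1)] by (simp add: w_def comp_def)
    obtain l where l: "\<And>f. f \<in> F \<Longrightarrow> (\<lambda>n. inner f (w n)) \<longlonglongrightarrow> l f"
      using s(2) unfolding convergent_def w_def comp_def by metis
    \<comment> \<open>An upper bound for \<mu>/2 times the distance of two members of the sequence;
      it tends to 0 jointly in both indices, whence the product filter.\<close>
    define h where "h = (\<lambda>(n, m). norm (D (w n)) + norm (D (w m))
        + C * (\<Sum>f\<in>F. \<bar>inner f (w n) - inner f (w m)\<bar>))"
    have hb: "\<mu>/2 * dist (w n) (w m) \<le> h (n, m)" for n m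
    proof -
      let ?d = "w n - w m"
      have "\<mu> * norm ?d = norm (D (w n) - D (w m) + X ?d)"
        using \<mu> by (simp add: D blinfun.diff_right algebra_simps flip: scaleR_diff_right)
      also have "\<dots> \<le> norm (D (w n)) + norm (D (w m)) + norm (X ?d)"
        using norm_triangle_ineq[of "D (w n) - D (w m)" "X ?d"] norm_triangle_ineq4[of "D (w n)" "D (w m)"]
        by linarith
      finally show ?thesis
        using F(2)[of ?d] by (simp add: h_def dist_norm inner_diff_right)
    qed
    have "((\<lambda>z. norm (D (w (fst z))) + norm (D (w (snd z)))
        + C * (\<Sum>f\<in>F. \<bar>inner f (w (fst z)) - inner f (w (snd z))\<bar>)) \<longlongrightarrow>
        0 + 0 + C * (\<Sum>f\<in>F. \<bar>l f - l f\<bar>)) (sequentially \<times>\<^sub>F sequentially)"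
      by (intro tendsto_intros filterlim_compose[OF rw] filterlim_compose[OF l] filterlim_fst filterlim_snd)
    then have "(h \<longlongrightarrow> 0) (sequentially \<times>\<^sub>F sequentially)"
      by (simp add: h_def case_prod_unfold)
    have "Cauchy w"
      unfolding Cauchy_def
    proof (intro allI impI)
      fix e :: real assume "e > 0"
      then have "\<forall>\<^sub>F z in sequentially \<times>\<^sub>F sequentially. h z < \<mu>/2 * e"
        using \<open>(h \<longlongrightarrow> 0) _\<close> \<mu> by (intro order_tendstoD) auto
      then obtain N where N: "\<And>m n. m \<ge> N \<Longrightarrow> n \<ge> N \<Longrightarrow> h (n, m) < \<mu>/2 * e"
        unfolding eventually_prod_sequentially by blast
      have "dist (w m) (w n) < e" if "m \<ge> N" "n \<ge> N" for m n
      proof -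
        have "\<mu>/2 * dist (w m) (w n) < \<mu>/2 * e"
          using hb[of m n] N[OF that(2,1)] by linarith
        then show ?thesis using \<mu> by simp
      qed
      then show "\<exists>M. \<forall>m\<ge>M. \<forall>n\<ge>M. dist (w m) (w n) < e" by blast
    qed
    then obtain y where y: "w \<longlonglongrightarrow> y"
      using Cauchy_convergent convergent_def by blast
    have "norm y = 1"
      using LIMSEQ_unique[OF tendsto_norm[OF y], of 1] v(2) by (simp add: w_def)
    moreover have "inner e y = 0" if "e \<in> E" for e
      using LIMSEQ_unique[OF tendsto_inner[OF tendsto_const y, of e], of 0] v(1) that
      by (simp add: w_def V_def)
    moreover have "(\<lambda>n. D (w n)) \<longlonglongrightarrow> D y"
      by (intro tendsto_intros y)
    then have "D y = 0"
      by (rule LIMSEQ_unique[OF _ tendsto_norm_zero_cancel[OF rw]])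
    then have "X y = \<mu> *\<^sub>R y" by (simp add: D)
    ultimately show ?thesis by blast
  qed
qed

text \<open>A maximal orthonormal family of eigenvectors has trivial orthogonal complement, since
  otherwise \<open>compact_op_eigenvector\<close> would extend it.\<close>

theorem compact_op_eigenbasis:
  fixes X :: "'a::{real_inner,complete_space} \<Rightarrow>\<^sub>L 'a"
  assumes X: "positive_op X" "compact_op X"
  shows "\<exists>E. orthonormal_basis E \<and> (\<forall>e\<in>E. X e = inner e (X e) *\<^sub>R e)"
proof -
  define \<A> where "\<A> = {E. orthonormal E \<and> (\<forall>e\<in>E. \<exists>\<mu>. X e = \<mu> *\<^sub>R e)}"
  have "\<exists>M\<in>\<A>. \<forall>E\<in>\<A>. M \<subseteq> E \<longrightarrow> E = M"
  proof (rule subset_Zorn)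
    fix C assume C: "subset.chain \<A> C"
    have "\<Union>C \<in> \<A>"
    proof -
      have "pairwise orthogonal (\<Union>C)"
        unfolding pairwise_def
      proof (intro ballI impI)
        fix x y assume "x \<in> \<Union>C" "y \<in> \<Union>C" "x \<noteq> y"
        then obtain E where "E \<in> C" "x \<in> E" "y \<in> E"
          using C unfolding subset_chain_def by blast
        then show "orthogonal x y"
          using C \<open>x \<noteq> y\<close> by (auto simp: subset_chain_def \<A>_def orthonormal_def pairwise_def subset_iff)
      qed
      then show ?thesis
        using C by (fastforce simp: subset_chain_def \<A>_def orthonormal_def subset_iff)
    qed
    then show "\<exists>U\<in>\<A>. \<forall>E\<in>C. E \<subseteq> U" by blast
  qed
  then obtain E where E: "orthonormal E" "\<And>e. e \<in> E \<Longrightarrow> \<exists>\<mu>. X e = \<mu> *\<^sub>R e"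
    and max: "\<And>E'. E' \<in> \<A> \<Longrightarrow> E \<subseteq> E' \<Longrightarrow> E' = E"
    by (auto simp: \<A>_def)
  have "u = 0" if u: "\<forall>e\<in>E. inner e u = 0" for u
  proof (rule ccontr)
    assume "u \<noteq> 0"
    then obtain v \<mu> where v: "norm v = 1" "\<forall>e\<in>E. inner e v = 0" "X v = \<mu> *\<^sub>R v"
      using compact_op_eigenvector[OF X E(2)] u by blast
    have "insert v E \<in> \<A>"
      using E v by (auto simp: \<A>_def orthonormal_def pairwise_insert orthogonal_def inner_commute)
    then have "v \<in> E" using max by blast
    then show False using v by fastforce
  qed
  then have "orthonormal_basis E" using E(1) by (simp add: orthonormal_basis_def)
  moreover have "X e = inner e (X e) *\<^sub>R e" if "e \<in> E" for e
    using E(2)[OF that] E(1) that by (auto simp: orthonormal_inner)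
  ultimately show ?thesis by auto
qed

subsection \<open>Polynomials of a positive operator\<close>

lemma norm_ell2_square: "((\<lambda>i. (cmod (coord x i))\<^sup>2) has_sum (norm x)\<^sup>2) UNIV"
proof -
  have "(\<lambda>i. (cmod (coord x i))\<^sup>2) summable_on UNIV" using coord[of x] by simp
  moreover have "(norm x)\<^sup>2 = (\<Sum>\<^sub>\<infinity>i. (cmod (coord x i))\<^sup>2)"
    by (simp add: norm_ell2_def infsum_nonneg)
  ultimately show ?thesis by (simp add: has_sum_infsum)
qed

lemma sum_coord_le_norm:
  assumes "finite F"
  shows "(\<Sum>i\<in>F. (cmod (coord x i))\<^sup>2) \<le> (norm x)\<^sup>2"
  using assms by (intro has_sum_mono_neutral[OF has_sum_finite norm_ell2_square]) auto

text \<open>Both the Riesz-Fischer argument and norm limits of polynomials of an operator rest on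
  this. The limit is formed coordinatewise; bounds on finite partial sums pass to it and then give
  convergence in norm.\<close>

instance ell2 :: (type) banach
proof
  fix X :: "nat \<Rightarrow> 'a ell2"
  assume X: "Cauchy X"
  have co: "cmod (coord (X m) i - coord (X n) i) \<le> dist (X m) (X n)" for m n i
  proof -
    have "(cmod (coord (X m - X n) i))\<^sup>2 \<le> (norm (X m - X n))\<^sup>2"
      using sum_coord_le_norm[of "{i}"] by simp
    then show ?thesis
      by (simp add: dist_norm minus_ell2.rep_eq abs_le_square_iff[symmetric])
  qed
  have "Cauchy (\<lambda>n. coord (X n) i)" for i
    unfolding Cauchy_def
  proof (intro allI impI)
    fix e :: real assume "e > 0"
    then obtain M where M: "\<And>m n. m \<ge> M \<Longrightarrow> n \<ge> M \<Longrightarrow> dist (X m) (X n) < e"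
      using X unfolding Cauchy_def by blast
    have "dist (coord (X m) i) (coord (X n) i) < e" if "m \<ge> M" "n \<ge> M" for m n
      unfolding dist_norm by (rule order_le_less_trans[OF co M[OF that]])
    then show "\<exists>M. \<forall>m\<ge>M. \<forall>n\<ge>M. dist (coord (X m) i) (coord (X n) i) < e" by blast
  qed
  then have "convergent (\<lambda>n. coord (X n) i)" for i
    by (rule Cauchy_convergent)
  then obtain y where y: "\<And>i. (\<lambda>n. coord (X n) i) \<longlonglongrightarrow> y i"
    unfolding convergent_def by metis
  have tail: "(\<Sum>i\<in>F. (cmod (coord (X n) i - y i))\<^sup>2) \<le> e\<^sup>2"
    if "finite F" and e: "\<And>m. m \<ge> M \<Longrightarrow> dist (X n) (X m) \<le> e" for F n e M
  proof (rule tendsto_upperbound)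
    show "(\<lambda>m. \<Sum>i\<in>F. (cmod (coord (X n) i - coord (X m) i))\<^sup>2) \<longlonglongrightarrow>
        (\<Sum>i\<in>F. (cmod (coord (X n) i - y i))\<^sup>2)"
      by (intro tendsto_intros y)
    have "(\<Sum>i\<in>F. (cmod (coord (X n) i - coord (X m) i))\<^sup>2) \<le> e\<^sup>2" if "m \<ge> M" for m
    proof -
      have "(\<Sum>i\<in>F. (cmod (coord (X n) i - coord (X m) i))\<^sup>2) \<le> (norm (X n - X m))\<^sup>2"
        using sum_coord_le_norm[OF \<open>finite F\<close>, of "X n - X m"] by (simp add: minus_ell2.rep_eq)
      also have "\<dots> \<le> e\<^sup>2" using e[OF that] by (intro power_mono) (auto simp: dist_norm)
      finally show ?thesis .
    qed
    then show "\<forall>\<^sub>F m in sequentially. (\<Sum>i\<in>F. (cmod (coord (X n) i - coord (X m) i))\<^sup>2) \<le> e\<^sup>2"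
      by (auto simp: eventually_sequentially)
  qed simp
  have summ: "(\<lambda>i. (cmod (coord (X n) i - y i))\<^sup>2) summable_on UNIV"
    if "\<And>m. m \<ge> M \<Longrightarrow> dist (X n) (X m) \<le> e" for n e M
    using tail[OF _ that] by (intro nonneg_bdd_above_summable_on bdd_aboveI[of _ "e\<^sup>2"]) auto
  obtain M where M: "\<And>m n. m \<ge> M \<Longrightarrow> n \<ge> M \<Longrightarrow> dist (X m) (X n) < 1"
    using X unfolding Cauchy_def by (meson zero_less_one)
  have "(\<lambda>i. (cmod (coord (X M) i - y i))\<^sup>2) summable_on UNIV"
    by (rule summ[of M _ 1]) (use M in \<open>auto intro: less_imp_le\<close>)
  moreover have "(\<lambda>i. (cmod (- coord (X M) i))\<^sup>2) summable_on UNIV"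
    using coord[of "X M"] by simp
  ultimately have "(\<lambda>i. (cmod ((coord (X M) i - y i) + - coord (X M) i))\<^sup>2) summable_on UNIV"
    by (rule square_summable_add)
  then have Y: "coord (Abs_ell2 y) = y"
    by (intro Abs_ell2_inverse) simp
  have "X \<longlonglongrightarrow> Abs_ell2 y"
    unfolding lim_sequentially
  proof (intro allI impI)
    fix e :: real assume e: "e > 0"
    then obtain N where N: "\<And>m n. m \<ge> N \<Longrightarrow> n \<ge> N \<Longrightarrow> dist (X m) (X n) < e/2"
      using X unfolding Cauchy_def by (meson half_gt_zero)
    have "dist (X n) (Abs_ell2 y) < e" if "n \<ge> N" for n
    proof -
      have "(norm (X n - Abs_ell2 y))\<^sup>2 = (\<Sum>\<^sub>\<infinity>i. (cmod (coord (X n) i - y i))\<^sup>2)"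
        using infsumI[OF norm_ell2_square[of "X n - Abs_ell2 y"]] by (simp add: minus_ell2.rep_eq Y)
      also have "\<dots> \<le> (e/2)\<^sup>2"
      proof -
        have le: "dist (X n) (X m) \<le> e/2" if "m \<ge> N" for m
          using N[OF \<open>n \<ge> N\<close> that] by simp
        show ?thesis
          by (rule infsum_le_finite_sums[OF summ[OF le] tail[OF _ le]])
      qed
      finally have "norm (X n - Abs_ell2 y) \<le> e/2"
        by (rule power2_le_imp_le) (use e in simp)
      then show ?thesis using e by (simp add: dist_norm)
    qed
    then show "\<exists>N. \<forall>n\<ge>N. dist (X n) (Abs_ell2 y) < e" by blast
  qed
  then show "convergent X" by (auto simp: convergent_def)
qed

section \<open>Algebra of the polynomial functional calculus\<close>

lemma op_poly_apply:
  assumes "degree q \<le> n"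
  shows "op_poly q A x = (\<Sum>k\<le>n. coeff q k *\<^sub>R (((o\<^sub>L) A ^^ k) id_blinfun) x)"
proof -
  have "op_poly q A x = (\<Sum>k\<le>degree q. coeff q k *\<^sub>R (((o\<^sub>L) A ^^ k) id_blinfun) x)"
    by (simp add: op_poly_def blinfun.sum_left blinfun.scaleR_left)
  also have "\<dots> = (\<Sum>k\<le>n. coeff q k *\<^sub>R (((o\<^sub>L) A ^^ k) id_blinfun) x)"
    using assms by (intro sum.mono_neutral_left) (auto simp: coeff_eq_0)
  finally show ?thesis .
qed

lemma op_poly_0 [simp]: "op_poly 0 A = 0"
  by (simp add: op_poly_def)

text \<open>Horner's rule; it lets the later facts go by induction on \<open>pCons\<close> without
  any reference to powers of A.\<close>

lemma op_poly_pCons [simp]: "op_poly (pCons a q) A x = a *\<^sub>R x + A (op_poly q A x)"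
proof -
  have "op_poly (pCons a q) A x
      = (\<Sum>k\<le>Suc (degree q). coeff (pCons a q) k *\<^sub>R (((o\<^sub>L) A ^^ k) id_blinfun) x)"
    by (rule op_poly_apply) (simp add: degree_pCons_le)
  also have "\<dots> = a *\<^sub>R x + (\<Sum>k\<le>degree q. coeff q k *\<^sub>R A ((((o\<^sub>L) A ^^ k) id_blinfun) x))"
    by (simp add: sum.atMost_Suc_shift del: sum.atMost_Suc)
  also have "\<dots> = a *\<^sub>R x + A (op_poly q A x)"
    by (simp add: op_poly_apply[OF order_refl] blinfun.sum_right blinfun.scaleR_right)
  finally show ?thesis .
qed

lemma op_poly_add: "op_poly (p + q) A = op_poly p A + op_poly q A"
proof (rule blinfun_eqI)
  fix x
  have "op_poly (p + q) A x
      = (\<Sum>k\<le>max (degree p) (degree q). coeff (p + q) k *\<^sub>R (((o\<^sub>L) A ^^ k) id_blinfun) x)"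
    by (rule op_poly_apply[OF degree_add_le_max])
  then show "op_poly (p + q) A x = (op_poly p A + op_poly q A) x"
    by (simp add: op_poly_apply[of p "max (degree p) (degree q)"]
        op_poly_apply[of q "max (degree p) (degree q)"] blinfun.add_left scaleR_add_left sum.distrib)
qed

lemma op_poly_smult: "op_poly (smult c p) A = c *\<^sub>R op_poly p A"
  by (rule blinfun_eqI) (simp add: op_poly_apply[of p, OF order_refl] op_poly_apply[of "smult c p" "degree p"]
      degree_smult_le blinfun.scaleR_left scaleR_sum_right)

lemma op_poly_diff: "op_poly (p - q) A = op_poly p A - op_poly q A"
  using op_poly_add[of "p - q" q A] by simp

lemma op_poly_mult: "op_poly (p * q) A = op_poly p A o\<^sub>L op_poly q A"
  by (rule blinfun_eqI, induction p)
     (simp_all add: op_poly_add op_poly_smult blinfun.add_left blinfun.scaleR_left)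

lemma op_poly_commute:
  assumes "\<And>x. blinfun_apply C (blinfun_apply A x) = blinfun_apply A (blinfun_apply C x)"
  shows "blinfun_apply C (op_poly q A x) = op_poly q A (blinfun_apply C x)"
  by (induction q arbitrary: x) (simp_all add: assms blinfun.add_right blinfun.scaleR_right)

lemma op_poly_eigenvector:
  "blinfun_apply A v = l *\<^sub>R v \<Longrightarrow> op_poly q A v = poly q l *\<^sub>R v"
  by (induction q) (simp_all add: blinfun.scaleR_right algebra_simps)

lemma op_poly_symmetric:
  assumes "positive_op A"
  shows "inner (op_poly q A x) y = inner x (op_poly q A y)"
proof (induction q arbitrary: x y)
  case (pCons a q)
  have "op_poly q A (A y) = A (op_poly q A y)"
    using op_poly_commute[of A A q y] by simp
  then show ?case
    by (simp add: inner_add_left inner_add_right positive_op_symmetric[OF assms] pCons.IH)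
qed simp

section \<open>Real factorization and positivity of polynomials of an operator\<close>

lemma poly_of_real_add:
  "poly (map_poly complex_of_real (p + q)) z = poly (map_poly of_real p) z + poly (map_poly of_real q) z"
  by (induction p q rule: poly_induct2) (simp_all add: map_poly_pCons algebra_simps)

lemma poly_of_real_smult:
  "poly (map_poly complex_of_real (smult c p)) z = of_real c * poly (map_poly of_real p) z"
  by (induction p) (simp_all add: map_poly_pCons algebra_simps)

lemma poly_of_real_mult:
  "poly (map_poly complex_of_real (p * q)) z = poly (map_poly of_real p) z * poly (map_poly of_real q) z"
  by (induction p) (simp_all add: map_poly_pCons poly_of_real_add poly_of_real_smult algebra_simps)

lemma poly_of_real_of_real:
  "poly (map_poly complex_of_real p) (of_real x) = of_real (poly p x)"
  by (induction p) (simp_all add: map_poly_pCons)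

text \<open>Outside the interval the form of A - a has a fixed sign and is at least c
  \<parallel>x\<parallel>^2 in absolute value, with c the distance from a to the interval;
  Cauchy-Schwarz turns this into a bound on norms.\<close>

lemma shift_bounded_below:
  fixes A :: "'i op"
  assumes A: "positive_op A" and a: "a \<notin> {0..norm A}"
  shows "\<exists>c>0. \<forall>x. c * norm x \<le> norm (A x - a *\<^sub>R x)"
proof -
  have form: "\<bar>inner x (A x - a *\<^sub>R x)\<bar> \<le> norm x * norm (A x - a *\<^sub>R x)" for x
    by (rule Cauchy_Schwarz_ineq2)
  have up: "inner x (A x) \<le> norm A * (norm x)\<^sup>2" for x
    using order_trans[OF norm_cauchy_schwarz mult_left_mono[OF norm_blinfun[of A x], of "norm x"]]
    by (simp add: power2_eq_square mult_ac)
  define c where "c = (if a < 0 then - a else a - norm A)"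
  have c: "c > 0" using a by (auto simp: c_def)
  have "c * norm x \<le> norm (A x - a *\<^sub>R x)" for x
  proof (cases "x = 0")
    case False
    have "inner x (A x - a *\<^sub>R x) = inner x (A x) - a * (norm x)\<^sup>2"
      by (simp add: inner_diff_right dot_square_norm)
    then have "c * (norm x)\<^sup>2 \<le> \<bar>inner x (A x - a *\<^sub>R x)\<bar>"
      using positive_op_nonneg[OF A, of x] up[of x] by (auto simp: c_def algebra_simps)
    then have "(c * norm x) * norm x \<le> norm (A x - a *\<^sub>R x) * norm x"
      using form[of x] by (simp add: power2_eq_square mult_ac)
    then show ?thesis using False by (simp add: mult_le_cancel_right)
  qed simp
  then show ?thesis using c by blast
qed

text \<open>Operators bounded below compose, so one irreducible real factor is split off at a time.
  A linear factor has its root outside the interval; a quadratic factor (t - a)^2 + b^2 gives the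
  constant b^2 for every symmetric A.\<close>

lemma op_poly_bounded_below:
  fixes A :: "'i op"
  assumes A: "positive_op A" and g: "\<And>t. t \<in> {0..norm A} \<Longrightarrow> poly g t \<noteq> 0"
  shows "\<exists>c>0. \<forall>x. c * norm x \<le> norm (op_poly g A x)"
  using g
proof (induction "degree g" arbitrary: g rule: less_induct)
  case less
  show ?case
  proof (cases "degree g = 0")
    case True
    then obtain a where a: "g = [:a:]" using degree_eq_zeroE by blast
    then have "a \<noteq> 0" using less.prems[of 0] by simp
    then show ?thesis by (intro exI[of _ "\<bar>a\<bar>"]) (simp add: a)
  next
    case False
    have g0: "g \<noteq> 0" using False by auto
    have "degree (map_poly complex_of_real g) \<noteq> 0"
      using False by (subst degree_map_poly) auto
    then obtain z where z: "poly (map_poly complex_of_real g) z = 0"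
      using fundamental_theorem_of_algebra[of "map_poly complex_of_real g"]
      by (auto simp: constant_degree)
    define a b where "a = Re z" and "b = Im z"
    have "\<exists>f h c. g = f * h \<and> degree f > 0 \<and> c > 0 \<and> (\<forall>x. c * norm x \<le> norm (op_poly f A x))"
    proof (cases "b = 0")
      case True
      then have "z = of_real a" by (simp add: a_def b_def complex_eq_iff)
      then have root: "poly g a = 0" using z by (simp add: poly_of_real_of_real)
      then obtain h where h: "g = [:-a, 1:] * h" by (metis dvdE poly_eq_0_iff_dvd)
      have "a \<notin> {0..norm A}" using root less.prems by blast
      then obtain c where "c > 0" "\<And>x. c * norm x \<le> norm (A x - a *\<^sub>R x)"
        using shift_bounded_below[OF A] by blast
      then show ?thesis using h
        by (intro exI[of _ "[:-a, 1:]"] exI[of _ h] exI[of _ c]) simp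
    next
      case False
      \<comment> \<open>The real quadratic whose roots are z and its conjugate.\<close>
      define f where "f = [:a\<^sup>2 + b\<^sup>2, - (2 * a), 1:]"
      have f: "poly (map_poly complex_of_real f) z = 0"
        by (simp add: f_def map_poly_pCons complex_eq_iff a_def b_def power2_eq_square algebra_simps)
      have df: "degree f = 2" by (simp add: f_def)
      have "poly (map_poly complex_of_real (g mod f)) z = 0"
        using z f poly_of_real_add[of "g div f * f" "g mod f" z] by (simp add: poly_of_real_mult)
      moreover have "degree (g mod f) \<le> 1"
        using degree_mod_less[of f g] df by (auto simp: f_def)
      then obtain u v where uv: "g mod f = [:u, v:]"
      proof -
        obtain u r where ur: "g mod f = pCons u r" by (cases "g mod f")
        then have "degree r = 0"
          using \<open>degree (g mod f) \<le> 1\<close> by (cases "r = 0") auto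
        then show ?thesis using that ur degree_eq_zeroE by metis
      qed
      \<comment> \<open>A real polynomial of degree at most 1 that vanishes at a nonreal point is
        zero, so f divides g.\<close>
      ultimately have "of_real u + z * of_real v = 0" by (simp add: map_poly_pCons)
      then have "v = 0" "u = 0"
        using False by (auto simp: complex_eq_iff b_def)
      then have "g mod f = 0" using uv by simp
      then have gf: "g = f * (g div f)" by (metis add.right_neutral div_mult_mod_eq mult.commute)
      have "b\<^sup>2 * norm x \<le> norm (op_poly f A x)" for x
      proof (cases "x = 0")
        case nz: False
        define y where "y = A x - a *\<^sub>R x"
        have "op_poly f A x = (A y - a *\<^sub>R y) + b\<^sup>2 *\<^sub>R x"
          by (simp add: y_def f_def blinfun.add_right blinfun.diff_right blinfun.scaleR_right
              scaleR_add_left scaleR_diff_right power2_eq_square)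
             (simp add: scaleR_2 flip: scaleR_scaleR)
        then have "inner x (op_poly f A x) = (inner (A x) y - a * inner x y) + b\<^sup>2 * (norm x)\<^sup>2"
          by (simp add: inner_add_right inner_diff_right dot_square_norm positive_op_symmetric[OF A])
        also have "inner (A x) y - a * inner x y = inner (A x - a *\<^sub>R x) y"
          by (simp add: inner_diff_left)
        also have "\<dots> = (norm y)\<^sup>2"
          by (simp add: dot_square_norm flip: y_def)
        finally have "inner x (op_poly f A x) = (norm y)\<^sup>2 + b\<^sup>2 * (norm x)\<^sup>2" .
        then have "b\<^sup>2 * (norm x)\<^sup>2 \<le> norm x * norm (op_poly f A x)"
          using norm_cauchy_schwarz[of x "op_poly f A x"] zero_le_power2[of "norm y"]
          by linarith
        then have "(b\<^sup>2 * norm x) * norm x \<le> norm (op_poly f A x) * norm x"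
          by (simp add: power2_eq_square mult_ac)
        then show ?thesis using nz by (simp add: mult_le_cancel_right)
      qed simp
      then show ?thesis using gf df False
        by (intro exI[of _ f] exI[of _ "g div f"] exI[of _ "b\<^sup>2"]) auto
    qed
    then obtain f h c where f: "g = f * h" "degree f > 0" "c > 0"
      "\<And>x. c * norm x \<le> norm (op_poly f A x)" by blast
    have "degree h < degree g" using f(1,2) g0 by (auto simp: degree_mult_eq)
    moreover have "poly h t \<noteq> 0" if "t \<in> {0..norm A}" for t
      using less.prems[OF that] f(1) by auto
    ultimately obtain d where d: "d > 0" "\<And>x. d * norm x \<le> norm (op_poly h A x)"
      using less.hyps by blast
    have "(c * d) * norm x \<le> norm (op_poly g A x)" for x
    proof -
      have "c * (d * norm x) \<le> c * norm (op_poly h A x)"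
        using d f(3) by (intro mult_left_mono) auto
      also have "\<dots> \<le> norm (op_poly f A (op_poly h A x))" by (rule f(4))
      finally show ?thesis by (simp add: f(1) op_poly_mult mult.assoc)
    qed
    then show ?thesis using f(3) d(1) by (intro exI[of _ "c * d"]) simp
  qed
qed

text \<open>An infimum \<open>\<mu> < 0\<close> of the form of \<open>q(A)\<close> is an approximate eigenvalue, but \<open>q - \<mu>\<close> has no root in
  \<open>[0, \<parallel>A\<parallel>]\<close>, so \<open>q(A) - \<mu>\<close> is bounded below.\<close>

theorem op_poly_nonneg:
  fixes A :: "'i op"
  assumes A: "positive_op A" and q: "\<And>t. t \<in> {0..norm A} \<Longrightarrow> 0 \<le> poly q t"
  shows "0 \<le> inner x (op_poly q A x)"
proof (rule ccontr)
  assume neg: "\<not> 0 \<le> inner x (op_poly q A x)"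
  then have x: "x \<noteq> 0" by auto
  define Q where "Q = {inner v (op_poly q A v) |v. norm v = 1}"
  define \<mu> where "\<mu> = Inf Q"
  have sgn: "inner (sgn v) (op_poly q A (sgn v)) = inner v (op_poly q A v) / (norm v)\<^sup>2" for v
    by (simp add: sgn_div_norm blinfun.scaleR_right power2_eq_square field_simps)
  have sgnx: "inner (sgn x) (op_poly q A (sgn x)) \<in> Q"
    using x by (auto simp: Q_def norm_sgn)
  have bd: "- norm (op_poly q A) \<le> inner v (op_poly q A v)" if "norm v = 1" for v
    using Cauchy_Schwarz_ineq2[of v "op_poly q A v"] norm_blinfun[of "op_poly q A" v] that by auto
  then have bdd: "bdd_below Q"
    by (intro bdd_belowI[of _ "- norm (op_poly q A)"]) (auto simp: Q_def)
  have "\<mu> \<le> inner (sgn x) (op_poly q A (sgn x))"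
    unfolding \<mu>_def by (intro cInf_lower sgnx bdd)
  also have "\<dots> < 0" using neg x by (simp add: sgn divide_neg_pos)
  finally have \<mu>: "\<mu> < 0" .
  define g where "g = q - [:\<mu>:]"
  define B where "B = op_poly g A"
  have B: "B v = op_poly q A v - \<mu> *\<^sub>R v" for v
    by (simp add: B_def g_def op_poly_diff blinfun.diff_left)
  have "poly g t \<noteq> 0" if "t \<in> {0..norm A}" for t
    using q[OF that] \<mu> by (simp add: g_def)
  then obtain c where c: "c > 0" "\<And>v. c * norm v \<le> norm (B v)"
    using op_poly_bounded_below[OF A, of g] by (auto simp: B_def)
  have Bpos: "0 \<le> inner v (B v)" for v
  proof (cases "v = 0")
    case False
    have "\<mu> \<le> inner (sgn v) (op_poly q A (sgn v))"
      unfolding \<mu>_def using False by (intro cInf_lower bdd) (auto simp: Q_def norm_sgn)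
    then show ?thesis using False by (simp add: sgn B inner_diff_right dot_square_norm field_simps)
  qed simp
  have BB: "(norm (B v))\<^sup>2 \<le> norm B * inner v (B v)" for v
    by (intro norm_square_le_quadratic_form Bpos) (simp add: B_def op_poly_symmetric[OF A])
  have pos: "norm B + 1 > 0" using norm_ge_zero[of B] by linarith
  \<comment> \<open>The slack is chosen so that \<parallel>B\<parallel> times it stays below c^2;
    the summand 1 covers B = 0.\<close>
  have "\<exists>y\<in>Q. y < \<mu> + c\<^sup>2 / (norm B + 1)"
    unfolding \<mu>_def using sgnx bdd c(1) pos by (subst cInf_less_iff[symmetric]) auto
  then obtain v where v: "norm v = 1" "inner v (B v) < c\<^sup>2 / (norm B + 1)"
    by (auto simp: Q_def B inner_diff_right dot_square_norm)
  have "c\<^sup>2 \<le> (norm (B v))\<^sup>2" using c c(2)[of v] v by (intro power_mono) auto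
  also have "\<dots> \<le> norm B * inner v (B v)" by (rule BB)
  also have "\<dots> \<le> norm B * (c\<^sup>2 / (norm B + 1))" using v by (intro mult_left_mono) auto
  also have "\<dots> < c\<^sup>2" using c(1) pos by (simp add: field_simps)
  finally show False by simp
qed

text \<open>Positivity applied to c^2 - q^2. It makes q \<mapsto> q(A) contractive for the supremum
  norm on the interval, which is what makes limits of polynomials meaningful.\<close>

lemma op_poly_norm_le:
  fixes A :: "'i op"
  assumes A: "positive_op A" and c: "c \<ge> 0" and q: "\<And>t. t \<in> {0..norm A} \<Longrightarrow> \<bar>poly q t\<bar> \<le> c"
  shows "norm (op_poly q A) \<le> c"
proof (rule norm_blinfun_bound[OF c])
  fix x
  have "0 \<le> inner x (op_poly ([:c\<^sup>2:] - q * q) A x)"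
  proof (rule op_poly_nonneg[OF A])
    fix t assume "t \<in> {0..norm A}"
    then have "\<bar>poly q t\<bar>\<^sup>2 \<le> c\<^sup>2" using q by (intro power_mono) auto
    then show "0 \<le> poly ([:c\<^sup>2:] - q * q) t" by (simp add: power2_eq_square)
  qed
  then have "(norm (op_poly q A x))\<^sup>2 \<le> (c * norm x)\<^sup>2"
    by (simp add: op_poly_diff op_poly_mult blinfun.diff_left inner_diff_right dot_square_norm
        op_poly_symmetric[OF A, of q x, symmetric] power_mult_distrib)
  then show "norm (op_poly q A x) \<le> c * norm x"
    by (rule power2_le_imp_le) (use c in simp)
qed

subsection \<open>Real powers of a positive operator\<close>

text \<open>Without an approximating sequence, every operator would vacuously satisfy the
  description in \<open>op_powr_def\<close>. Positivity of r makes the power continuous at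
  0.\<close>

lemma powr_poly_approx:
  fixes M r :: real
  assumes r: "r > 0"
  shows "\<exists>q. uniform_limit {0..M} (\<lambda>n t. poly (q n) t) (\<lambda>t. t powr r) sequentially"
proof -
  have "continuous_on {0..M} (\<lambda>t. t powr r)"
    using r by (intro continuous_on_powr' continuous_intros) auto
  have "\<exists>q. \<forall>t\<in>{0..M}. \<bar>t powr r - poly q t\<bar> < inverse (real (Suc n))" for n
  proof -
    obtain g where g: "real_polynomial_function g"
      "\<And>t. t \<in> {0..M} \<Longrightarrow> \<bar>t powr r - g t\<bar> < inverse (real (Suc n))"
      using Stone_Weierstrass_real_polynomial_function[OF compact_Icc \<open>continuous_on _ _\<close>,
          of "inverse (real (Suc n))"] by auto
    obtain a m where "g = (\<lambda>x. \<Sum>i\<le>m. a i * x ^ i)"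
      using g(1) unfolding real_polynomial_function_iff_sum by blast
    then have "poly (\<Sum>i\<le>m. monom (a i) i) t = g t" for t
      by (simp add: poly_sum poly_monom)
    then show ?thesis using g(2) by metis
  qed
  then obtain q where q: "\<And>n t. t \<in> {0..M} \<Longrightarrow> \<bar>t powr r - poly (q n) t\<bar> < inverse (real (Suc n))"
    by metis
  have "uniform_limit {0..M} (\<lambda>n t. poly (q n) t) (\<lambda>t. t powr r) sequentially"
  proof (rule uniform_limitI)
    fix e :: real assume "0 < e"
    then have "\<forall>\<^sub>F n in sequentially. inverse (real (Suc n)) < e"
      by (rule order_tendstoD(2)[OF LIMSEQ_inverse_real_of_nat])
    then show "\<forall>\<^sub>F n in sequentially. \<forall>t\<in>{0..M}. dist (poly (q n) t) (t powr r) < e"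
    proof eventually_elim
      case (elim n)
      then show ?case using q[of _ n] by (fastforce simp: dist_real_def abs_minus_commute)
    qed
  qed
  then show ?thesis by blast
qed

text \<open>With p = q this is the Cauchy property; with different sequences it shows that the limit
  does not depend on the choice.\<close>

lemma op_poly_close:
  fixes A :: "'i op"
  assumes A: "positive_op A" and e: "e > 0"
    and p: "uniform_limit {0..norm A} (\<lambda>n t. poly (p n) t) f sequentially"
    and q: "uniform_limit {0..norm A} (\<lambda>n t. poly (q n) t) f sequentially"
  shows "\<exists>N. \<forall>m\<ge>N. \<forall>n\<ge>N. norm (op_poly (p m) A - op_poly (q n) A) \<le> e"
proof -
  have "\<forall>\<^sub>F n in sequentially. \<forall>t\<in>{0..norm A}. dist (poly (p n) t) (f t) < e/2"
    "\<forall>\<^sub>F n in sequentially. \<forall>t\<in>{0..norm A}. dist (poly (q n) t) (f t) < e/2"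
    using uniform_limitD[OF p, of "e/2"] uniform_limitD[OF q, of "e/2"] e by auto
  then have "\<forall>\<^sub>F n in sequentially. (\<forall>t\<in>{0..norm A}. dist (poly (p n) t) (f t) < e/2) \<and>
      (\<forall>t\<in>{0..norm A}. dist (poly (q n) t) (f t) < e/2)"
    by (rule eventually_conj)
  then obtain N where N: "\<And>n t. n \<ge> N \<Longrightarrow> t \<in> {0..norm A} \<Longrightarrow> dist (poly (p n) t) (f t) < e/2"
    "\<And>n t. n \<ge> N \<Longrightarrow> t \<in> {0..norm A} \<Longrightarrow> dist (poly (q n) t) (f t) < e/2"
    unfolding eventually_sequentially by blast
  have "norm (op_poly (p m) A - op_poly (q n) A) \<le> e" if "m \<ge> N" "n \<ge> N" for m n
  proof -
    have "\<bar>poly (p m - q n) t\<bar> \<le> e" if "t \<in> {0..norm A}" for t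
      using N(1)[OF \<open>m \<ge> N\<close> that] N(2)[OF \<open>n \<ge> N\<close> that] unfolding dist_real_def poly_diff
      by linarith
    then have "norm (op_poly (p m - q n) A) \<le> e"
      using e by (intro op_poly_norm_le[OF A]) auto
    then show ?thesis by (simp add: op_poly_diff)
  qed
  then show ?thesis by blast
qed

theorem op_powr_tendsto:
  fixes A :: "'i op"
  assumes A: "positive_op A" and r: "r > 0"
    and q: "uniform_limit {0..norm A} (\<lambda>n t. poly (q n) t) (\<lambda>t. t powr r) sequentially"
  shows "(\<lambda>n. op_poly (q n) A) \<longlonglongrightarrow> op_powr A r"
proof -
  let ?U = "\<lambda>q :: nat \<Rightarrow> real poly.
    uniform_limit {0..norm A} (\<lambda>n t. poly (q n) t) (\<lambda>t. t powr r) sequentially"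
  have "Cauchy (\<lambda>n. op_poly (q n) A)"
    unfolding Cauchy_def
  proof (intro allI impI)
    fix e :: real assume "e > 0"
    then obtain N where "\<And>m n. m \<ge> N \<Longrightarrow> n \<ge> N \<Longrightarrow> norm (op_poly (q m) A - op_poly (q n) A) \<le> e/2"
      using op_poly_close[OF A _ q q, of "e/2"] by auto
    then have "dist (op_poly (q m) A) (op_poly (q n) A) < e" if "m \<ge> N" "n \<ge> N" for m n
      using that \<open>e > 0\<close> by (fastforce simp: dist_norm)
    then show "\<exists>N. \<forall>m\<ge>N. \<forall>n\<ge>N. dist (op_poly (q m) A) (op_poly (q n) A) < e" by blast
  qed
  then have "convergent (\<lambda>n. op_poly (q n) A)" by (rule Cauchy_convergent)
  then obtain B where B: "(\<lambda>n. op_poly (q n) A) \<longlonglongrightarrow> B" by (auto simp: convergent_def)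
  have lim: "(\<lambda>n. op_poly (p n) A) \<longlonglongrightarrow> B" if p: "?U p" for p
  proof -
    have "(\<lambda>n. op_poly (p n) A - op_poly (q n) A) \<longlonglongrightarrow> 0"
      unfolding LIMSEQ_iff
    proof (intro allI impI)
      fix e :: real assume "e > 0"
      then obtain N where N: "\<And>m n. m \<ge> N \<Longrightarrow> n \<ge> N \<Longrightarrow> norm (op_poly (p m) A - op_poly (q n) A) \<le> e/2"
        using op_poly_close[OF A _ p q, of "e/2"] by auto
      have "norm (op_poly (p n) A - op_poly (q n) A - 0) < e" if "n \<ge> N" for n
        using N[OF that that] \<open>e > 0\<close> by simp
      then show "\<exists>N. \<forall>n\<ge>N. norm (op_poly (p n) A - op_poly (q n) A - 0) < e" by blast
    qed
    then show ?thesis using tendsto_add[OF _ B] by fastforce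
  qed
  have "op_powr A r = B"
    unfolding op_powr_def
  proof (rule the_equality)
    show "\<forall>q. ?U q \<longrightarrow> (\<lambda>n. op_poly (q n) A) \<longlonglongrightarrow> B" using lim by blast
    show "C = B" if "\<forall>q. ?U q \<longrightarrow> (\<lambda>n. op_poly (q n) A) \<longlonglongrightarrow> C" for C
      using that q B LIMSEQ_unique by blast
  qed
  with B show ?thesis by simp
qed

lemma op_powr_obtain:
  fixes A :: "'i op"
  assumes A: "positive_op A" and r: "r > 0"
  obtains q where "uniform_limit {0..norm A} (\<lambda>n t. poly (q n) t) (\<lambda>t. t powr r) sequentially"
    and "\<And>x. (\<lambda>n. op_poly (q n) A x) \<longlonglongrightarrow> op_powr A r x"
proof -
  obtain q where q: "uniform_limit {0..norm A} (\<lambda>n t. poly (q n) t) (\<lambda>t. t powr r) sequentially"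
    using powr_poly_approx[OF r] by blast
  have "(\<lambda>n. op_poly (q n) A x) \<longlonglongrightarrow> op_powr A r x" for x
    by (intro tendsto_intros op_powr_tendsto[OF A r q])
  with q show ?thesis by (rule that)
qed

text \<open>The main device for transferring scalar inequalities to operators. Replacing the power
  by a close polynomial costs an error that a small constant compensates, and
  \<open>op_poly_nonneg\<close> applies to the result.\<close>

lemma op_powr_nonneg:
  fixes A :: "'i op"
  assumes A: "positive_op A" and r: "r > 0"
    and u: "\<And>t. t \<in> {0..norm A} \<Longrightarrow> 0 \<le> poly u t + c * t powr r"
  shows "0 \<le> inner x (op_poly u A x) + c * inner x (op_powr A r x)"
proof (rule field_le_epsilon)
  fix e :: real assume e: "e > 0"
  obtain q where q: "uniform_limit {0..norm A} (\<lambda>n t. poly (q n) t) (\<lambda>t. t powr r) sequentially"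
    "\<And>x. (\<lambda>n. op_poly (q n) A x) \<longlonglongrightarrow> op_powr A r x"
    using op_powr_obtain[OF A r] by blast
  \<comment> \<open>Chosen so that |c| d \<parallel>x\<parallel>^2 \<le> e; the two summands 1
    prevent division by zero.\<close>
  define d where "d = e / ((\<bar>c\<bar> + 1) * ((norm x)\<^sup>2 + 1))"
  have pos: "(norm x)\<^sup>2 + 1 > 0" by (smt (verit) zero_le_power2)
  have d: "d > 0" using e pos by (simp add: d_def)
  have "\<forall>\<^sub>F n in sequentially. \<forall>t\<in>{0..norm A}. dist (poly (q n) t) (t powr r) < d"
    by (rule uniform_limitD[OF q(1) d])
  then have "\<forall>\<^sub>F n in sequentially. 0 \<le> inner x (op_poly u A x) + c * inner x (op_poly (q n) A x) + e"
  proof eventually_elim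
    case (elim n)
    have "0 \<le> inner x (op_poly (u + smult c (q n) + [:\<bar>c\<bar> * d:]) A x)"
    proof (rule op_poly_nonneg[OF A])
      fix t assume t: "t \<in> {0..norm A}"
      have "\<bar>c * (poly (q n) t - t powr r)\<bar> \<le> \<bar>c\<bar> * d"
        unfolding abs_mult using elim t
        by (intro mult_left_mono) (auto simp: dist_real_def intro: less_imp_le)
      then show "0 \<le> poly (u + smult c (q n) + [:\<bar>c\<bar> * d:]) t"
        using u[of t] t by (auto simp: right_diff_distrib)
    qed
    also have "\<dots> = inner x (op_poly u A x) + c * inner x (op_poly (q n) A x) + \<bar>c\<bar> * d * (norm x)\<^sup>2"
      by (simp add: op_poly_add op_poly_smult blinfun.add_left blinfun.scaleR_left inner_add_right
          dot_square_norm)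
    also have "\<bar>c\<bar> * d * (norm x)\<^sup>2 \<le> (\<bar>c\<bar> + 1) * d * ((norm x)\<^sup>2 + 1)"
      using d by (intro mult_mono) auto
    also have "\<dots> = e" using pos by (simp add: d_def add_nonneg_eq_0_iff)
    finally show ?case by simp
  qed
  moreover have "(\<lambda>n. inner x (op_poly u A x) + c * inner x (op_poly (q n) A x) + e)
      \<longlonglongrightarrow> inner x (op_poly u A x) + c * inner x (op_powr A r x) + e"
    by (intro tendsto_add tendsto_mult tendsto_inner tendsto_const q(2))
  ultimately show "0 \<le> inner x (op_poly u A x) + c * inner x (op_powr A r x) + e"
    by (intro tendsto_lowerbound) auto
qed

lemma positive_op_powr:
  fixes A :: "'i op"
  assumes A: "positive_op A" and r: "r > 0"
  shows "positive_op (op_powr A r)"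
  unfolding positive_op_def
proof (intro conjI allI)
  obtain q where q: "\<And>x. (\<lambda>n. op_poly (q n) A x) \<longlonglongrightarrow> op_powr A r x"
    using op_powr_obtain[OF A r] by blast
  fix x y
  have "(\<lambda>n. inner (op_poly (q n) A x) y) \<longlonglongrightarrow> inner (op_powr A r x) y"
    "(\<lambda>n. inner x (op_poly (q n) A y)) \<longlonglongrightarrow> inner x (op_powr A r y)"
    by (intro tendsto_intros q)+
  then show "inner (op_powr A r x) y = inner x (op_powr A r y)"
    by (simp add: op_poly_symmetric[OF A] LIMSEQ_unique)
next
  show "0 \<le> inner x (op_powr A r x)" for x
    using op_powr_nonneg[OF A r, of 0 1 x] by simp
qed

lemma op_powr_eigenvector:
  fixes A :: "'i op"
  assumes A: "positive_op A" and r: "r > 0" and v: "A v = l *\<^sub>R v" and l: "l \<ge> 0"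
  shows "op_powr A r v = (l powr r) *\<^sub>R v"
proof (cases "v = 0")
  case False
  obtain q where q: "uniform_limit {0..norm A} (\<lambda>n t. poly (q n) t) (\<lambda>t. t powr r) sequentially"
    "\<And>x. (\<lambda>n. op_poly (q n) A x) \<longlonglongrightarrow> op_powr A r x"
    using op_powr_obtain[OF A r] by blast
  have "l * norm v \<le> norm A * norm v"
    using norm_blinfun[of A v] v l by simp
  then have "l \<in> {0..norm A}" using False l by (simp add: mult_le_cancel_right)
  then have "(\<lambda>n. poly (q n) l) \<longlonglongrightarrow> l powr r"
    by (rule tendsto_uniform_limitI[OF q(1)])
  then have "(\<lambda>n. poly (q n) l *\<^sub>R v) \<longlonglongrightarrow> (l powr r) *\<^sub>R v"
    by (intro tendsto_intros)
  then show ?thesis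
    using q(2)[of v] by (simp add: op_poly_eigenvector[OF v] LIMSEQ_unique)
qed simp

text \<open>Used with C = multiplication by \<open>\<i>\<close>, to see that powers of a
  complex-linear operator respect the complex structure.\<close>

lemma op_powr_commute:
  fixes A C :: "'i op"
  assumes A: "positive_op A" and r: "r > 0" and C: "\<And>x. C (A x) = A (C x)"
  shows "C (op_powr A r x) = op_powr A r (C x)"
proof -
  obtain q where q: "\<And>x. (\<lambda>n. op_poly (q n) A x) \<longlonglongrightarrow> op_powr A r x"
    using op_powr_obtain[OF A r] by blast
  have "(\<lambda>n. C (op_poly (q n) A x)) \<longlonglongrightarrow> C (op_powr A r x)"
    by (intro tendsto_intros q)
  moreover have "C (op_poly (q n) A x) = op_poly (q n) A (C x)" for n
    by (rule op_poly_commute[OF C])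
  ultimately show ?thesis using q[of "C x"] by (simp add: LIMSEQ_unique)
qed

text \<open>Both the squares of polynomials approximating the square root and the constant sequence
  \<open>[:0, 1:]\<close> tend to t uniformly, so their operator limits coincide.\<close>

lemma op_powr_half_square:
  fixes A :: "'i op"
  assumes A: "positive_op A"
  shows "op_powr A (1/2) (op_powr A (1/2) x) = A x"
proof -
  obtain q where q: "uniform_limit {0..norm A} (\<lambda>n t. poly (q n) t) (\<lambda>t. t powr (1/2)) sequentially"
    using powr_poly_approx[of "1/2"] by auto
  have lim: "(\<lambda>n. op_poly (q n) A) \<longlonglongrightarrow> op_powr A (1/2)"
    by (rule op_powr_tendsto[OF A _ q]) simp
  have bd: "bounded ((\<lambda>t. t powr (1/2)) ` {0..norm A})"
    by (intro compact_imp_bounded compact_continuous_image continuous_on_powr' continuous_intros) auto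
  have "uniform_limit {0..norm A} (\<lambda>n t. poly (q n) t * poly (q n) t)
      (\<lambda>t. t powr (1/2) * t powr (1/2)) sequentially"
    by (intro uniform_lim_mult q bd)
  then have "uniform_limit {0..norm A} (\<lambda>n t. poly (q n * q n) t) (\<lambda>t. t powr 1) sequentially"
    by (simp flip: powr_add)
  then have 1: "(\<lambda>n. op_poly (q n * q n) A) \<longlonglongrightarrow> op_powr A 1"
    by (intro op_powr_tendsto[OF A]) simp_all
  have "uniform_limit {0..norm A} (\<lambda>n t. poly [:0, 1:] t) (\<lambda>t. t powr 1) sequentially"
    by (rule uniform_limitI) (auto simp: dist_real_def)
  then have 2: "(\<lambda>n. op_poly [:0, 1:] A) \<longlonglongrightarrow> op_powr A 1"
    by (intro op_powr_tendsto[OF A]) simp_all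
  have "op_poly [:0, 1:] A = op_powr A 1"
    using 2 by (simp only: LIMSEQ_const_iff)
  moreover have "(\<lambda>n. op_poly (q n) A (op_poly (q n) A x)) \<longlonglongrightarrow> op_powr A (1/2) (op_powr A (1/2) x)"
    by (intro tendsto_intros lim)
  moreover have "(\<lambda>n. op_poly (q n * q n) A x) \<longlonglongrightarrow> op_powr A 1 x"
    by (intro tendsto_intros 1)
  then have "(\<lambda>n. op_poly (q n) A (op_poly (q n) A x)) \<longlonglongrightarrow> op_powr A 1 x"
    by (simp add: op_poly_mult)
  ultimately have "op_powr A (1/2) (op_powr A (1/2) x) = op_poly [:0, 1:] A x"
    by (simp only: LIMSEQ_unique)
  then show ?thesis by simp
qed

subsection \<open>The trace and the modulus\<close>

lemma has_sum_finite_sum: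
  fixes f :: "'a \<Rightarrow> 'b \<Rightarrow> 'c::topological_comm_monoid_add"
  assumes "finite F" "\<And>i. i \<in> F \<Longrightarrow> (f i has_sum s i) A"
  shows "((\<lambda>x. \<Sum>i\<in>F. f i x) has_sum (\<Sum>i\<in>F. s i)) A"
  using assms by (induction F rule: finite_induct) (auto intro!: has_sum_add)

text \<open>The squares of the matrix entries of Q between the two families are summed in two
  orders, with Parseval in one and Bessel in the other. Finiteness of G makes the interchange a
  finite sum of convergent sums.\<close>

lemma square_norm_sum_le_basis:
  fixes Q :: "'a::{real_inner,complete_space} \<Rightarrow>\<^sub>L 'a"
  assumes Q: "positive_op Q" and B: "orthonormal_basis B" and G: "orthonormal G" "finite G"
    and s: "((\<lambda>b. (norm (Q b))\<^sup>2) has_sum s) B"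
  shows "(\<Sum>e\<in>G. (norm (Q e))\<^sup>2) \<le> s"
proof (rule has_sum_mono)
  show "((\<lambda>b. \<Sum>e\<in>G. (inner b (Q e))\<^sup>2) has_sum (\<Sum>e\<in>G. (norm (Q e))\<^sup>2)) B"
    by (intro has_sum_finite_sum parseval B G)
  show "((\<lambda>b. (norm (Q b))\<^sup>2) has_sum s) B" by (rule s)
  show "(\<Sum>e\<in>G. (inner b (Q e))\<^sup>2) \<le> (norm (Q b))\<^sup>2" for b
  proof -
    have "inner b (Q e) = inner e (Q b)" for e
      using positive_op_symmetric[OF Q, of b e] by (simp add: inner_commute)
    then show ?thesis using bessel_finite[OF G, of "Q b"] by simp
  qed
qed

lemma square_norm_sum_basis_independent:
  fixes Q :: "'a::{real_inner,complete_space} \<Rightarrow>\<^sub>L 'a"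
  assumes Q: "positive_op Q" and B: "orthonormal_basis B" and G: "orthonormal_basis G"
    and s: "((\<lambda>b. (norm (Q b))\<^sup>2) has_sum s) B"
  shows "((\<lambda>b. (norm (Q b))\<^sup>2) has_sum s) G"
proof -
  have le: "(\<Sum>e\<in>F. (norm (Q e))\<^sup>2) \<le> s" if "finite F" "F \<subseteq> G" for F
    using that G by (intro square_norm_sum_le_basis[OF Q B _ _ s])
      (auto simp: orthonormal_basis_def intro: orthonormal_subset)
  then have "(\<lambda>e. (norm (Q e))\<^sup>2) summable_on G"
    by (intro nonneg_bdd_above_summable_on bdd_aboveI[of _ s]) auto
  then obtain t where t: "((\<lambda>e. (norm (Q e))\<^sup>2) has_sum t) G" by (auto simp: summable_on_def)
  have "t \<le> s" by (rule has_sum_le_finite_sums[OF t le])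
  moreover have "s \<le> t"
    using B by (intro has_sum_le_finite_sums[OF s] square_norm_sum_le_basis[OF Q G _ _ t])
      (auto simp: orthonormal_basis_def intro: orthonormal_subset)
  ultimately show ?thesis using t by simp
qed

section \<open>The complex structure seen through the real inner product\<close>

lemma coord_basis_vec: "coord (basis_vec i) j = (if j = i then 1 else 0)"
  by (simp add: basis_vec.rep_eq)

lemma cinner_basis_vec: "cinner (basis_vec i) x = coord x i"
proof -
  have "((\<lambda>j. cnj (coord (basis_vec i) j) * coord x j) has_sum coord x i) UNIV"
    by (rule has_sum_finite_neutralI[of "{i}"]) (auto simp: coord_basis_vec)
  then show ?thesis by (simp add: cinner_def infsumI)
qed

lemma cinner_commute: "cinner y x = cnj (cinner x y)"
  unfolding cinner_def infsum_cnj[symmetric] by (simp add: mult.commute)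

lemma cinner_scale_right: "cinner x (a *\<^sub>C y) = a * cinner x y"
proof -
  have "((\<lambda>i. a * (cnj (coord x i) * coord y i)) has_sum a * cinner x y) UNIV"
    unfolding cinner_def by (intro has_sum_cmult_right has_sum_infsum cinner_summable)
  then show ?thesis by (simp add: cinner_def cscale.rep_eq infsumI mult_ac)
qed

lemma cinner_scale_left: "cinner (a *\<^sub>C x) y = cnj a * cinner x y"
  by (subst cinner_commute) (simp add: cinner_scale_right cinner_commute[of x y])

lemma inner_cscale_i: "inner (\<i> *\<^sub>C x) y = - inner x (\<i> *\<^sub>C y)"
  by (simp add: inner_ell2_def cinner_scale_left cinner_scale_right)

text \<open>Reduces identities for \<open>cinner\<close>, such as the one that defines
  \<open>adj\<close>, to the real inner product and multiplication by \<open>\<i>\<close>.\<close>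

lemma cinner_eq_inner: "cinner x y = Complex (inner x y) (inner (\<i> *\<^sub>C x) y)"
  by (simp add: inner_ell2_def cinner_scale_left complex_eq_iff)

lemma cscale_i_i: "\<i> *\<^sub>C (\<i> *\<^sub>C x) = - x"
  by transfer (simp add: fun_eq_iff)

lemma cscale_of_real: "complex_of_real r *\<^sub>C x = r *\<^sub>R x"
  by transfer simp

text \<open>For the real inner product every vector is orthogonal to its multiple by
  \<open>\<i>\<close>, so both families are needed to span.\<close>

definition real_basis :: "'i ell2 set" where
  "real_basis = range basis_vec \<union> range (\<lambda>i. \<i> *\<^sub>C basis_vec i)"

lemma inner_basis_vec: "inner (basis_vec i) x = Re (coord x i)"
  by (simp add: inner_ell2_def cinner_basis_vec)

lemma inner_i_basis_vec: "inner (\<i> *\<^sub>C basis_vec i) x = Im (coord x i)"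
  by (simp add: inner_ell2_def cinner_basis_vec cinner_scale_left)

lemma real_basis_orthonormal_basis: "orthonormal_basis (real_basis :: 'i ell2 set)"
proof -
  have n: "norm (basis_vec i :: 'i ell2) = 1" for i
    by (simp add: norm_eq_sqrt_inner inner_basis_vec coord_basis_vec)
  have "x = 0" if "\<forall>b\<in>real_basis. inner b x = 0" for x :: "'i ell2"
  proof -
    have "inner (basis_vec i) x = 0" "inner (\<i> *\<^sub>C basis_vec i) x = 0" for i
      using that by (auto simp: real_basis_def)
    then have "coord x i = 0" for i
      by (simp add: inner_basis_vec inner_i_basis_vec complex_eq_iff)
    then show ?thesis by (simp add: coord_inject[symmetric] zero_ell2.rep_eq fun_eq_iff)
  qed
  moreover have "orthonormal (real_basis :: 'i ell2 set)"
    unfolding orthonormal_def pairwise_def orthogonal_def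
    by (auto simp: real_basis_def n norm_cscale inner_basis_vec inner_i_basis_vec coord_basis_vec
        cscale.rep_eq)
  ultimately show ?thesis by (simp add: orthonormal_basis_def)
qed

lemma infsum_ennreal_finite:
  fixes f :: "'a \<Rightarrow> real"
  assumes f: "\<And>x. x \<in> A \<Longrightarrow> f x \<ge> 0" and fin: "(\<Sum>\<^sub>\<infinity>x\<in>A. ennreal (f x)) < \<infinity>"
  shows "(f has_sum enn2real (\<Sum>\<^sub>\<infinity>x\<in>A. ennreal (f x))) A"
proof -
  let ?S = "\<Sum>\<^sub>\<infinity>x\<in>A. ennreal (f x)"
  have S: "?S = (SUP F\<in>{F. finite F \<and> F \<subseteq> A}. \<Sum>x\<in>F. ennreal (f x))"
    by (rule nonneg_infsum_complete) simp
  also have "\<dots> = (SUP F\<in>{F. finite F \<and> F \<subseteq> A}. ennreal (sum f F))"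
    using f by (intro SUP_cong sum_ennreal) auto
  finally have S': "?S = (SUP F\<in>{F. finite F \<and> F \<subseteq> A}. ennreal (sum f F))" .
  have "sum f F \<le> enn2real ?S" if "finite F" "F \<subseteq> A" for F
  proof -
    have "ennreal (sum f F) \<le> ?S" unfolding S' using that by (intro SUP_upper) auto
    then have "enn2real (ennreal (sum f F)) \<le> enn2real ?S"
      using fin by (intro enn2real_mono) auto
    moreover have "sum f F \<ge> 0" using f that by (intro sum_nonneg) auto
    ultimately show ?thesis by simp
  qed
  then have "f summable_on A"
    using f by (intro nonneg_bdd_above_summable_on bdd_aboveI[of _ "enn2real ?S"]) auto
  moreover from this have "ennreal (infsum f A) = ?S"
    using f unfolding S' by (rule infsum_nonneg_is_SUPREMUM_ennreal)
  then have "infsum f A = enn2real ?S"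
    using f by (metis enn2real_ennreal infsum_nonneg)
  ultimately show ?thesis by (metis has_sum_infsum)
qed

text \<open>The real basis contains each basis vector twice, up to the factor \<open>\<i>\<close>; hence the factor 2.\<close>

lemma pos_trace_real_basis:
  fixes S :: "'i op"
  assumes S: "positive_op S" "\<And>x. S (\<i> *\<^sub>C x) = \<i> *\<^sub>C S x" and fin: "pos_trace S < \<infinity>"
  shows "((\<lambda>b. inner b (S b)) has_sum 2 * enn2real (pos_trace S)) real_basis"
proof -
  have tr: "pos_trace S = (\<Sum>\<^sub>\<infinity>i. ennreal (inner (basis_vec i) (S (basis_vec i))))"
    by (simp add: pos_trace_def inner_ell2_def)
  have h: "((\<lambda>i. inner (basis_vec i) (S (basis_vec i))) has_sum enn2real (pos_trace S)) UNIV"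
    unfolding tr using fin by (intro infsum_ennreal_finite positive_op_nonneg S) (simp_all add: tr)
  have ii: "inner (\<i> *\<^sub>C x) (S (\<i> *\<^sub>C x)) = inner x (S x)" for x
    by (simp add: S(2) inner_cscale_i cscale_i_i)
  have inj1: "inj (basis_vec :: 'i \<Rightarrow> 'i ell2)"
    by (rule injI) (metis coord_basis_vec zero_neq_one)
  moreover have "inj (\<lambda>x :: 'i ell2. \<i> *\<^sub>C x)"
    by (rule injI) (metis cscale_i_i minus_minus)
  ultimately have inj2: "inj (\<lambda>i :: 'i. \<i> *\<^sub>C (basis_vec i :: 'i ell2))"
    using inj_compose[of "\<lambda>x :: 'i ell2. \<i> *\<^sub>C x" basis_vec] by (simp add: comp_def)
  have disj: "range basis_vec \<inter> range (\<lambda>i. \<i> *\<^sub>C (basis_vec i :: 'i ell2)) = {}"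
  proof -
    have "basis_vec i \<noteq> \<i> *\<^sub>C (basis_vec j :: 'i ell2)" for i j
      using inner_basis_vec[of i "basis_vec i :: 'i ell2"] inner_basis_vec[of i "\<i> *\<^sub>C basis_vec j :: 'i ell2"]
      by (auto simp: coord_basis_vec cscale.rep_eq split: if_splits)
    then show ?thesis by blast
  qed
  have "((\<lambda>b. inner b (S b)) has_sum (enn2real (pos_trace S) + enn2real (pos_trace S))) real_basis"
    unfolding real_basis_def
    by (intro has_sum_Un_disjoint disj) (simp_all add: has_sum_reindex inj1 inj2 comp_def ii h)
  then show ?thesis by simp
qed

text \<open>The imaginary part of \<open>cinner\<close> is the real inner product with the left
  vector multiplied by \<open>\<i>\<close>, and T commutes with \<open>\<i>\<close>; hence the real
  adjoint is also the complex one.\<close>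

lemma bounded_ops_real_adjoint:
  fixes T S :: "'i op"
  assumes T: "T \<in> bounded_ops"
    and S: "\<And>x y. inner (S x) y = inner x (T y)"
  shows "adj T = S"
  unfolding adj_def
proof (rule the_equality)
  have Ti: "T (\<i> *\<^sub>C x) = \<i> *\<^sub>C T x" for x using T by (simp add: bounded_ops_def)
  have "inner (\<i> *\<^sub>C S x) y = inner (\<i> *\<^sub>C x) (T y)" for x y
    by (simp add: inner_cscale_i S Ti)
  then show "\<forall>x y. cinner (S x) y = cinner x (T y)"
    by (simp add: cinner_eq_inner S)
  fix R :: "'i op" assume R: "\<forall>x y. cinner (R x) y = cinner x (T y)"
  have "inner (R x) y = inner (S x) y" for x y
    using R by (simp add: S) (simp add: inner_ell2_def)
  then show "R = S" by (intro blinfun_eqI) (metis vector_eq_rdot)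
qed

lemma inner_adj:
  assumes T: "T \<in> bounded_ops"
  shows "inner (adj T x) y = inner x (T y)"
proof -
  obtain S :: "'a op" where S: "\<And>x y. inner (S x) y = inner x (T y)"
    using adjoint_exists[OF real_basis_orthonormal_basis, of T] by blast
  then show ?thesis using bounded_ops_real_adjoint[OF T S] by simp
qed

lemma adj_cscale_i:
  assumes T: "T \<in> bounded_ops"
  shows "adj T (\<i> *\<^sub>C x) = \<i> *\<^sub>C adj T x"
proof -
  have "inner (adj T (\<i> *\<^sub>C x)) y = inner (\<i> *\<^sub>C adj T x) y" for y
    using T by (simp add: inner_adj[OF T] inner_cscale_i bounded_ops_def)
  then show ?thesis by (metis vector_eq_rdot)
qed

lemma inner_gram:
  assumes T: "T \<in> bounded_ops"
  shows "inner x ((adj T o\<^sub>L T) y) = inner (T x) (T y)"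
  using inner_adj[OF T, of "T y" x] by (simp add: inner_commute)

lemma positive_gram:
  assumes T: "T \<in> bounded_ops"
  shows "positive_op (adj T o\<^sub>L T)"
  unfolding positive_op_def
  using inner_gram[OF T] by (metis inner_commute inner_ge_zero)

lemma positive_op_abs:
  assumes T: "T \<in> bounded_ops"
  shows "positive_op (op_abs T)"
  unfolding op_abs_def by (intro positive_op_powr positive_gram T) simp

lemma op_abs_square:
  assumes T: "T \<in> bounded_ops"
  shows "op_abs T (op_abs T x) = adj T (T x)"
  unfolding op_abs_def by (simp add: op_powr_half_square[OF positive_gram[OF T]])

lemma inner_op_abs_square:
  assumes T: "T \<in> bounded_ops"
  shows "inner x (op_abs T (op_abs T x)) = (norm (T x))\<^sup>2"
  using inner_gram[OF T, of x x] by (simp add: op_abs_square[OF T] dot_square_norm)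

lemma op_abs_power_eigenvector:
  assumes T: "T \<in> bounded_ops" and p: "p > 0" and e: "adj T (T e) = l *\<^sub>R e" and l: "l \<ge> 0"
  shows "op_powr (op_abs T) p e = (l powr (p/2)) *\<^sub>R e"
proof -
  have "op_abs T e = (l powr (1/2)) *\<^sub>R e"
    unfolding op_abs_def
    by (rule op_powr_eigenvector[OF positive_gram[OF T] _ _ l]) (simp_all add: e)
  then have "op_powr (op_abs T) p e = ((l powr (1/2)) powr p) *\<^sub>R e"
    by (rule op_powr_eigenvector[OF positive_op_abs[OF T] p]) simp
  then show ?thesis by (simp add: powr_powr)
qed

lemma op_abs_power_cscale_i:
  assumes T: "T \<in> bounded_ops" and p: "p > 0"
  shows "op_powr (op_abs T) p (\<i> *\<^sub>C x) = \<i> *\<^sub>C op_powr (op_abs T) p x"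
proof -
  let ?C = "Blinfun (\<lambda>x :: 'a ell2. \<i> *\<^sub>C x)"
  have C: "?C x = \<i> *\<^sub>C x" for x
    by (simp add: bounded_linear_Blinfun_apply bounded_linear_cscale)
  have "?C ((adj T o\<^sub>L T) x) = (adj T o\<^sub>L T) (?C x)" for x
    using T by (simp add: C adj_cscale_i bounded_ops_def)
  then have "?C (op_abs T x) = op_abs T (?C x)" for x
    unfolding op_abs_def by (intro op_powr_commute positive_gram T) auto
  then have "?C (op_powr (op_abs T) p x) = op_powr (op_abs T) p (?C x)" for x
    by (intro op_powr_commute positive_op_abs T p)
  then show ?thesis by (simp add: C)
qed

section \<open>Tangent inequalities and Jensen's inequality for powers of the modulus\<close>

lemma young_tangent:
  fixes y \<theta> :: real
  assumes "y \<ge> 0" "0 < \<theta>" "\<theta> \<le> 1"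
  shows "y powr \<theta> \<le> 1 + \<theta> * (y - 1)"
proof (cases "y = 0")
  case False
  then show ?thesis
    using Youngs_inequality_0[of \<theta> "1 - \<theta>" y 1] assms by (simp add: algebra_simps)
qed (use assms in simp)

text \<open>The tangent at s^2 of t^p as a convex function of t^2. The variable is t^2 because
  \<langle>e, |T|^2 e\<rangle> = \<parallel>T e\<parallel>^2 is the moment that is known. Convexity
  is drawn from the concave tangent inequality for the inverse exponent 2/p.\<close>

lemma powr_tangent_ge:
  fixes s t p :: real
  assumes p: "p \<ge> 2" and s: "s > 0" and t: "t \<ge> 0"
  shows "s powr p + (p/2) * s powr p / s\<^sup>2 * (t\<^sup>2 - s\<^sup>2) \<le> t powr p"
proof -
  define u where "u = t powr p / s powr p"
  have u0: "u \<ge> 0" by (simp add: u_def)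
  have "u powr (2/p) \<le> 1 + 2/p * (u - 1)"
    using p u0 by (intro young_tangent) auto
  moreover have "u powr (2/p) = t\<^sup>2 / s\<^sup>2"
  proof -
    have "u powr (2/p) = (t/s) powr 2"
      using p s t by (simp add: u_def powr_powr flip: powr_divide)
    also have "\<dots> = (t/s)^2" using s t by (simp add: powr_numeral)
    finally show ?thesis by (simp add: power_divide)
  qed
  ultimately have "(p/2) * (t\<^sup>2 / s\<^sup>2 - 1) + 1 \<le> u"
    using p by (simp add: field_simps)
  then have "((p/2) * (t\<^sup>2 / s\<^sup>2 - 1) + 1) * s powr p \<le> u * s powr p"
    by (intro mult_right_mono) auto
  also have "u * s powr p = t powr p" using s by (simp add: u_def)
  finally show ?thesis using s by (simp add: field_simps)
qed

lemma powr_tangent_le: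
  fixes s t p :: real
  assumes p: "0 < p" "p \<le> 2" and s: "s > 0" and t: "t \<ge> 0"
  shows "t powr p \<le> s powr p + (p/2) * s powr p / s\<^sup>2 * (t\<^sup>2 - s\<^sup>2)"
proof -
  have "((t/s)\<^sup>2) powr (p/2) \<le> 1 + p/2 * ((t/s)\<^sup>2 - 1)"
    using p by (intro young_tangent) auto
  moreover have "((t/s)\<^sup>2) powr (p/2) = t powr p / s powr p"
    using s t by (simp add: powr_divide powr_powr flip: powr_numeral)
  ultimately have "(t powr p / s powr p) * s powr p \<le> (1 + p/2 * ((t/s)\<^sup>2 - 1)) * s powr p"
    by (intro mult_right_mono) auto
  then show ?thesis using s by (simp add: field_simps)
qed

text \<open>The tangent is taken at s = \<parallel>T e\<parallel>. Its linear term contributes a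
  multiple of \<langle>e, |T|^2 e\<rangle> - s^2 = 0, and the constant s^p remains.\<close>

lemma op_abs_power_ge:
  assumes T: "T \<in> bounded_ops" and p: "p \<ge> 2" and e: "norm e = 1"
  shows "norm (T e) powr p \<le> inner e (op_powr (op_abs T) p e)"
proof (cases "T e = 0")
  case True
  then show ?thesis
    using positive_op_nonneg[OF positive_op_powr[OF positive_op_abs[OF T]]] p by simp
next
  case False
  define s where "s = norm (T e)"
  have s: "s > 0" using False by (simp add: s_def)
  define \<beta> where "\<beta> = (p/2) * s powr p / s\<^sup>2"
  have "0 \<le> inner e (op_poly [:- (s powr p - \<beta> * s\<^sup>2), 0, - \<beta>:] (op_abs T) e)
      + 1 * inner e (op_powr (op_abs T) p e)"
  proof (rule op_powr_nonneg[OF positive_op_abs[OF T]])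
    fix t assume "t \<in> {0..norm (op_abs T)}"
    then show "0 \<le> poly [:- (s powr p - \<beta> * s\<^sup>2), 0, - \<beta>:] t + 1 * t powr p"
      using powr_tangent_ge[OF p s, of t, folded \<beta>_def]
      by (simp add: power2_eq_square algebra_simps)
  qed (use p in simp)
  then show ?thesis
    using e by (simp add: inner_diff_right inner_add_right blinfun.scaleR_right blinfun.minus_right
        inner_op_abs_square[OF T] dot_square_norm s_def[symmetric])
qed

lemma op_abs_power_le:
  assumes T: "T \<in> bounded_ops" and p: "0 < p" "p \<le> 2" and e: "norm e = 1"
  shows "inner e (op_powr (op_abs T) p e) \<le> norm (T e) powr p"
proof (cases "T e = 0")
  case True
  \<comment> \<open>There is no tangent at s = 0; instead e is an eigenvector for the eigenvalue 0,
    and \<open>0 powr (p/2) = 0\<close>.\<close>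
  then have "op_powr (op_abs T) p e = (0 powr (p/2)) *\<^sub>R e"
    by (intro op_abs_power_eigenvector T p) simp_all
  then show ?thesis using p by simp
next
  case False
  define s where "s = norm (T e)"
  have s: "s > 0" using False by (simp add: s_def)
  define \<beta> where "\<beta> = (p/2) * s powr p / s\<^sup>2"
  have "0 \<le> inner e (op_poly [:s powr p - \<beta> * s\<^sup>2, 0, \<beta>:] (op_abs T) e)
      + (-1) * inner e (op_powr (op_abs T) p e)"
  proof (rule op_powr_nonneg[OF positive_op_abs[OF T]])
    fix t assume "t \<in> {0..norm (op_abs T)}"
    then show "0 \<le> poly [:s powr p - \<beta> * s\<^sup>2, 0, \<beta>:] t + (-1) * t powr p"
      using powr_tangent_le[OF p s, of t, folded \<beta>_def]
      by (simp add: power2_eq_square algebra_simps)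
  qed (use p in simp)
  then show ?thesis
    using e by (simp add: inner_diff_right inner_add_right blinfun.scaleR_right
        inner_op_abs_square[OF T] dot_square_norm s_def[symmetric])
qed

subsection \<open>Schatten classes\<close>

lemma compact_op_add:
  assumes A: "compact_op A" and B: "compact_op B"
  shows "compact_op (A + B)"
  unfolding compact_op_def
proof (intro allI impI)
  fix \<epsilon> :: real assume "\<epsilon> > 0"
  then have "\<epsilon>/2 > 0" by simp
  then obtain F C G D where F: "finite F" "\<And>x. norm (A x) \<le> \<epsilon>/2 * norm x + C * (\<Sum>f\<in>F. \<bar>inner f x\<bar>)"
    and G: "finite G" "\<And>x. norm (B x) \<le> \<epsilon>/2 * norm x + D * (\<Sum>f\<in>G. \<bar>inner f x\<bar>)"
    using A B unfolding compact_op_def by meson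
  have "norm ((A + B) x) \<le> \<epsilon> * norm x + (\<bar>C\<bar> + \<bar>D\<bar>) * (\<Sum>f\<in>F \<union> G. \<bar>inner f x\<bar>)" for x
  proof -
    have "C * (\<Sum>f\<in>F. \<bar>inner f x\<bar>) \<le> \<bar>C\<bar> * (\<Sum>f\<in>F \<union> G. \<bar>inner f x\<bar>)"
      "D * (\<Sum>f\<in>G. \<bar>inner f x\<bar>) \<le> \<bar>D\<bar> * (\<Sum>f\<in>F \<union> G. \<bar>inner f x\<bar>)"
      using F(1) G(1) by (auto intro!: mult_mono sum_mono2 sum_nonneg)
    then show ?thesis
      using norm_triangle_ineq[of "A x" "B x"] F(2)[of x] G(2)[of x]
      by (simp add: blinfun.add_left distrib_right)
  qed
  then show "\<exists>F C. finite F \<and> (\<forall>x. norm ((A + B) x) \<le> \<epsilon> * norm x + C * (\<Sum>f\<in>F. \<bar>inner f x\<bar>))"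
    using F(1) G(1) by (meson finite_UnI)
qed

lemma compact_op_dominated:
  fixes A B :: "'a::real_inner \<Rightarrow>\<^sub>L 'a"
  assumes A: "compact_op A"
    and dom: "\<And>\<epsilon>. \<epsilon> > 0 \<Longrightarrow> \<exists>K\<ge>0. \<forall>x. norm (B x) \<le> \<epsilon> * norm x + K * norm (A x)"
  shows "compact_op B"
  unfolding compact_op_def
proof (intro allI impI)
  fix \<epsilon> :: real assume \<epsilon>: "\<epsilon> > 0"
  then obtain K where K: "K \<ge> 0" "\<And>x. norm (B x) \<le> \<epsilon>/2 * norm x + K * norm (A x)"
    using dom[of "\<epsilon>/2"] by auto
  \<comment> \<open>The compactness constant for A has to survive multiplication by K; the summand 1
    covers K = 0.\<close>
  define \<delta> where "\<delta> = \<epsilon> / (2 * (K + 1))"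
  have \<delta>: "\<delta> > 0" "K * \<delta> \<le> \<epsilon>/2" using K(1) \<epsilon> by (auto simp: \<delta>_def field_simps)
  obtain F C where F: "finite F" "\<And>x. norm (A x) \<le> \<delta> * norm x + C * (\<Sum>f\<in>F. \<bar>inner f x\<bar>)"
    using A \<delta>(1) unfolding compact_op_def by blast
  have "norm (B x) \<le> \<epsilon> * norm x + (K * C) * (\<Sum>f\<in>F. \<bar>inner f x\<bar>)" for x
  proof -
    have "K * norm (A x) \<le> K * (\<delta> * norm x + C * (\<Sum>f\<in>F. \<bar>inner f x\<bar>))"
      by (intro mult_left_mono F K)
    moreover have "(K * \<delta>) * norm x \<le> \<epsilon>/2 * norm x"
      by (intro mult_right_mono \<delta>) simp
    ultimately show ?thesis using K(2)[of x] by (simp add: algebra_simps)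
  qed
  then show "\<exists>F C. finite F \<and> (\<forall>x. norm (B x) \<le> \<epsilon> * norm x + C * (\<Sum>f\<in>F. \<bar>inner f x\<bar>))"
    using F(1) by blast
qed

text \<open>The square root turns the diagonal entries of |T|^p into squared norms, whose sum is
  already known to be independent of the basis.\<close>

lemma schatten_root:
  assumes T: "T \<in> schatten p" and p: "p > 0" and G: "orthonormal_basis G"
  defines "Q \<equiv> op_powr (op_powr (op_abs T) p) (1/2)"
  shows "(norm (Q x))\<^sup>2 = inner x (op_powr (op_abs T) p x)"
    and "((\<lambda>e. (norm (Q e))\<^sup>2) has_sum 2 * schatten_norm p T powr p) G"
proof -
  let ?S = "op_powr (op_abs T) p"
  have b: "T \<in> bounded_ops" and fin: "pos_trace ?S < \<infinity>"
    using T by (auto simp: schatten_def)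
  have S: "positive_op ?S" by (intro positive_op_powr positive_op_abs b p)
  have Q: "positive_op Q" unfolding Q_def by (intro positive_op_powr S) simp
  show n: "(norm (Q x))\<^sup>2 = inner x (?S x)" for x
    using op_powr_half_square[OF S, of x] positive_op_symmetric[OF Q, of x "Q x"]
    by (simp add: Q_def dot_square_norm)
  have "((\<lambda>b. inner b (?S b)) has_sum 2 * enn2real (pos_trace ?S)) real_basis"
    by (intro pos_trace_real_basis S op_abs_power_cscale_i b p fin)
  then have "((\<lambda>b. (norm (Q b))\<^sup>2) has_sum 2 * enn2real (pos_trace ?S)) real_basis"
    by (simp add: n)
  then have "((\<lambda>e. (norm (Q e))\<^sup>2) has_sum 2 * enn2real (pos_trace ?S)) G"
    by (rule square_norm_sum_basis_independent[OF Q real_basis_orthonormal_basis G])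
  moreover have "schatten_norm p T powr p = enn2real (pos_trace ?S)"
    using p by (simp add: schatten_norm_def powr_powr)
  ultimately show "((\<lambda>e. (norm (Q e))\<^sup>2) has_sum 2 * schatten_norm p T powr p) G" by simp
qed

lemma schatten_trace:
  assumes "T \<in> schatten p" "p > 0" "orthonormal_basis G"
  shows "((\<lambda>e. inner e (op_powr (op_abs T) p e)) has_sum 2 * schatten_norm p T powr p) G"
  using schatten_root[OF assms] by simp

text \<open>Q = (|T|^p)^(1/2) is Hilbert-Schmidt, hence compact. T is dominated by Q up to
  \<epsilon> \<parallel>x\<parallel>, because t^2 \<le> \<epsilon>^2 + C t^p on [0, M].\<close>

lemma schatten_compact:
  assumes T: "T \<in> schatten p" and p: "p > 0"
  shows "compact_op T"
proof -
  let ?S = "op_powr (op_abs T) p"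
  define Q where "Q = op_powr ?S (1/2)"
  have b: "T \<in> bounded_ops" using T by (auto simp: schatten_def)
  note Q = schatten_root[OF T p real_basis_orthonormal_basis, folded Q_def]
  have "compact_op Q"
    by (rule hilbert_schmidt_compact[OF real_basis_orthonormal_basis has_sum_imp_summable[OF Q(2)]])
  then show ?thesis
  proof (rule compact_op_dominated)
    fix \<epsilon> :: real assume \<epsilon>: "\<epsilon> > 0"
    define M where "M = norm (op_abs T)"
    \<comment> \<open>For t > \<epsilon> this makes C t^p at least M^2, which bounds t^2.\<close>
    define C where "C = M\<^sup>2 / \<epsilon> powr p"
    have C: "C \<ge> 0" by (simp add: C_def)
    have "norm (T x) \<le> \<epsilon> * norm x + sqrt C * norm (Q x)" for x
    proof -
      have "0 \<le> inner x (op_poly [:\<epsilon>\<^sup>2, 0, -1:] (op_abs T) x) + C * inner x (?S x)"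
      proof (rule op_powr_nonneg[OF positive_op_abs[OF b] p])
        fix t assume t: "t \<in> {0..norm (op_abs T)}"
        have "t\<^sup>2 \<le> \<epsilon>\<^sup>2 + C * t powr p"
        proof (cases "t \<le> \<epsilon>")
          case True
          then have "t\<^sup>2 \<le> \<epsilon>\<^sup>2" using t by (intro power_mono) auto
          then show ?thesis using C by (simp add: add_increasing2)
        next
          case False
          have "t\<^sup>2 \<le> M\<^sup>2" using t by (intro power_mono) (auto simp: M_def)
          also have "\<dots> = C * \<epsilon> powr p" using \<epsilon> by (simp add: C_def)
          also have "\<dots> \<le> C * t powr p"
            using False \<epsilon> p C by (intro mult_left_mono powr_mono2) auto
          finally show ?thesis by (simp add: add_increasing)
        qed
        then show "0 \<le> poly [:\<epsilon>\<^sup>2, 0, -1:] t + C * t powr p"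
          by (simp add: power2_eq_square)
      qed
      then have "(norm (T x))\<^sup>2 \<le> \<epsilon>\<^sup>2 * (norm x)\<^sup>2 + C * (norm (Q x))\<^sup>2"
        by (simp add: inner_add_right inner_diff_right blinfun.minus_right inner_op_abs_square[OF b]
            dot_square_norm Q(1))
      also have "\<dots> \<le> (\<epsilon> * norm x + sqrt C * norm (Q x))\<^sup>2"
        using \<epsilon> C by (simp add: power2_sum power_mult_distrib)
      finally show ?thesis
        by (rule power2_le_imp_le) (use \<epsilon> C in simp)
    qed
    then show "\<exists>K\<ge>0. \<forall>x. norm (T x) \<le> \<epsilon> * norm x + K * norm (Q x)"
      using C by (intro exI[of _ "sqrt C"]) simp
  qed
qed

lemma compact_op_compose_left:
  assumes T: "compact_op T"
  shows "compact_op (S o\<^sub>L T)"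
  using T
proof (rule compact_op_dominated)
  fix \<epsilon> :: real assume "\<epsilon> > 0"
  then show "\<exists>K\<ge>0. \<forall>x. norm ((S o\<^sub>L T) x) \<le> \<epsilon> * norm x + K * norm (T x)"
    by (intro exI[of _ "norm S"]) (simp add: norm_blinfun add_increasing)
qed

text \<open>On an eigenvector of |T|^2 Jensen's inequality becomes an equality, so the trace of
  |T|^p can be read off from the norms of \<open>T e\<close>.\<close>

lemma gram_eigenbasis:
  fixes T :: "'i op"
  assumes T: "T \<in> schatten p" and p: "p > 0"
  obtains G where "orthonormal_basis G" "\<And>e. e \<in> G \<Longrightarrow> adj T (T e) = (norm (T e))\<^sup>2 *\<^sub>R e"
    and "\<And>e. e \<in> G \<Longrightarrow> inner e (op_powr (op_abs T) p e) = norm (T e) powr p"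
proof -
  have b: "T \<in> bounded_ops" using T by (auto simp: schatten_def)
  obtain G where G: "orthonormal_basis G"
    "\<forall>e\<in>G. (adj T o\<^sub>L T) e = inner e ((adj T o\<^sub>L T) e) *\<^sub>R e"
    using compact_op_eigenbasis[OF positive_gram[OF b] compact_op_compose_left[OF schatten_compact[OF T p]]]
    by blast
  have eig: "adj T (T e) = (norm (T e))\<^sup>2 *\<^sub>R e" if "e \<in> G" for e
  proof -
    have "(adj T o\<^sub>L T) e = inner e ((adj T o\<^sub>L T) e) *\<^sub>R e" using G(2) that by blast
    then show ?thesis by (simp only: inner_gram[OF b] dot_square_norm) simp
  qed
  have "inner e (op_powr (op_abs T) p e) = norm (T e) powr p" if "e \<in> G" for e
  proof -
    have "op_powr (op_abs T) p e = (((norm (T e))\<^sup>2) powr (p/2)) *\<^sub>R e"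
      by (rule op_abs_power_eigenvector[OF b p eig[OF that]]) simp
    moreover have "norm e = 1"
      using G(1) that by (simp add: orthonormal_basis_def orthonormal_def)
    ultimately show ?thesis
      by (simp add: dot_square_norm powr_powr flip: powr_numeral)
  qed
  with G(1) eig show ?thesis by (rule that)
qed

section \<open>Scalar power inequalities and Clarkson's inequalities for vectors\<close>

lemma powr_midpoint_concave:
  fixes a b r :: real
  assumes a: "a \<ge> 0" and b: "b \<ge> 0" and r: "0 < r" "r \<le> 1"
  shows "a powr r + b powr r \<le> 2 * ((a + b) / 2) powr r"
proof (cases "a + b = 0")
  case True
  then show ?thesis using a b by (simp add: add_nonneg_eq_0_iff)
next
  case False
  define m where "m = (a + b) / 2"
  have m: "m > 0" using False a b by (simp add: m_def)
  have "a + b = 2 * m" by (simp add: m_def)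
  then have ab: "(a + b)/m = 2" using m by simp
  have "(a/m) powr r + (b/m) powr r \<le> (1 + r * (a/m - 1)) + (1 + r * (b/m - 1))"
    using a b m r by (intro add_mono young_tangent) auto
  also have "\<dots> = 2 + r * ((a + b)/m - 2)" by (simp add: algebra_simps add_divide_distrib)
  also have "\<dots> = 2" using ab by simp
  finally have "((a/m) powr r + (b/m) powr r) * m powr r \<le> 2 * m powr r"
    by (intro mult_right_mono) auto
  then show ?thesis using a b m by (simp add: powr_divide distrib_right m_def[symmetric])
qed

text \<open>The tangents at the midpoint have first-order terms that cancel in the sum. The convex
  tangent inequality comes from \<open>young_tangent\<close> with exponent 1/r.\<close>

lemma powr_midpoint_convex:
  fixes a b r :: real
  assumes a: "a \<ge> 0" and b: "b \<ge> 0" and r: "1 \<le> r"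
  shows "2 * ((a + b) / 2) powr r \<le> a powr r + b powr r"
proof (cases "a + b = 0")
  case True
  then show ?thesis using a b by (simp add: add_nonneg_eq_0_iff)
next
  case False
  define m where "m = (a + b) / 2"
  have m: "m > 0" using False a b by (simp add: m_def)
  have "a + b = 2 * m" by (simp add: m_def)
  then have ab: "(a + b)/m = 2" using m by simp
  have *: "1 + r * (y/m - 1) \<le> (y/m) powr r" if "y \<ge> 0" for y
  proof -
    have "((y/m) powr r) powr (1/r) \<le> 1 + (1/r) * ((y/m) powr r - 1)"
      using r by (intro young_tangent) auto
    moreover have "((y/m) powr r) powr (1/r) = y/m"
      using r m that by (simp add: powr_powr)
    ultimately have "y/m \<le> 1 + (1/r) * ((y/m) powr r - 1)" by simp
    then have "r * (y/m) \<le> r * (1 + (1/r) * ((y/m) powr r - 1))"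
      using r by (intro mult_left_mono) auto
    then show ?thesis using r by (simp add: distrib_left right_diff_distrib)
  qed
  have "2 = 2 + r * ((a + b)/m - 2)" using ab by simp
  also have "\<dots> = (1 + r * (a/m - 1)) + (1 + r * (b/m - 1))"
    by (simp add: algebra_simps add_divide_distrib)
  also have "\<dots> \<le> (a/m) powr r + (b/m) powr r"
    by (intro add_mono * a b)
  finally have "2 * m powr r \<le> ((a/m) powr r + (b/m) powr r) * m powr r"
    by (intro mult_right_mono) auto
  then show ?thesis using a b m by (simp add: powr_divide distrib_right m_def[symmetric])
qed

text \<open>After scaling to a + b = 1 it is y^r \<le> y on [0, 1].\<close>

lemma powr_superadditive:
  fixes a b r :: real
  assumes a: "a \<ge> 0" and b: "b \<ge> 0" and r: "1 \<le> r"
  shows "a powr r + b powr r \<le> (a + b) powr r"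
proof (cases "a + b = 0")
  case True
  then show ?thesis using a b by (simp add: add_nonneg_eq_0_iff)
next
  case False
  define m where "m = a + b"
  have m: "m > 0" using False a b by (simp add: m_def)
  have "(y/m) powr r \<le> y/m" if "0 \<le> y" "y \<le> m" for y
    using powr_mono'[of 1 r "y/m"] that m r by simp
  then have "(a/m) powr r + (b/m) powr r \<le> a/m + b/m"
    using a b by (intro add_mono) (auto simp: m_def)
  also have "\<dots> = 1" using m by (simp add: m_def flip: add_divide_distrib)
  finally have "((a/m) powr r + (b/m) powr r) * m powr r \<le> 1 * m powr r"
    by (intro mult_right_mono) auto
  then show ?thesis using a b m by (simp add: powr_divide distrib_right m_def[symmetric])
qed

lemma parallelogram: "(norm (u + v))\<^sup>2 + (norm (u - v))\<^sup>2 = 2 * ((norm u)\<^sup>2 + (norm v)\<^sup>2)"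
  for u v :: "'a::real_inner"
  by (simp add: power2_norm_eq_inner inner_add inner_diff inner_commute)

lemma powr_square_half: "((norm x)\<^sup>2) powr (p/2) = norm x powr p"
  by (simp add: powr_powr flip: powr_numeral)

text \<open>Superadditivity of the power p/2 merges the left-hand side into the parallelogram
  identity, and midpoint convexity separates u and v again. The factor is 4^(p/2) / 2.\<close>

lemma clarkson_vector:
  fixes u v :: "'a::real_inner"
  assumes p: "p \<ge> 2"
  shows "norm (u + v) powr p + norm (u - v) powr p \<le> 2 powr (p - 1) * (norm u powr p + norm v powr p)"
proof -
  let ?a = "(norm u)\<^sup>2" and ?b = "(norm v)\<^sup>2"
  have "norm (u + v) powr p + norm (u - v) powr p
      \<le> ((norm (u + v))\<^sup>2 + (norm (u - v))\<^sup>2) powr (p/2)"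
    using powr_superadditive[of "(norm (u + v))\<^sup>2" "(norm (u - v))\<^sup>2" "p/2"] p
    by (simp add: powr_square_half)
  also have "(norm (u + v))\<^sup>2 + (norm (u - v))\<^sup>2 = 2\<^sup>2 * ((?a + ?b) / 2)"
    unfolding parallelogram by simp
  also have "(2\<^sup>2 * ((?a + ?b) / 2)) powr (p/2) = 2 powr (p - 1) * (2 * ((?a + ?b) / 2) powr (p/2))"
  proof -
    have "(2\<^sup>2 :: real) powr (p/2) = 2 powr (p - 1) * 2"
      using powr_square_half[of "2 :: real" p] powr_add[of "2 :: real" "p - 1" 1] by simp
    then show ?thesis by (simp only: powr_mult)
  qed
  also have "\<dots> \<le> 2 powr (p - 1) * (?a powr (p/2) + ?b powr (p/2))"
    using p by (intro mult_left_mono powr_midpoint_convex) auto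
  finally show ?thesis by (simp add: powr_square_half)
qed

text \<open>Midpoint concavity of the power p/2; by the parallelogram identity the midpoint is
  \<parallel>u\<parallel>^2 + \<parallel>v\<parallel>^2, which equals \<langle>e, Z e\<rangle> when
  u = A e and v = B e.\<close>

lemma clarkson_vector_concave:
  fixes u v :: "'a::real_inner"
  assumes p: "0 < p" "p \<le> 2"
  shows "norm (u + v) powr p + norm (u - v) powr p \<le> 2 * ((norm u)\<^sup>2 + (norm v)\<^sup>2) powr (p/2)"
proof -
  have "((norm (u + v))\<^sup>2 + (norm (u - v))\<^sup>2) / 2 = (norm u)\<^sup>2 + (norm v)\<^sup>2"
    unfolding parallelogram by simp
  moreover have "((norm (u + v))\<^sup>2) powr (p/2) + ((norm (u - v))\<^sup>2) powr (p/2)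
      \<le> 2 * (((norm (u + v))\<^sup>2 + (norm (u - v))\<^sup>2) / 2) powr (p/2)"
    using p by (intro powr_midpoint_concave) auto
  ultimately show ?thesis by (simp only: powr_square_half)
qed

text \<open>One of the two summands in Rotfel'd's inequality: \<open>F\<close> consists of eigenvectors, with eigenvalues \<open>z\<close>,
  of some \<open>Z \<ge> |A|\<^sup>2\<close>, and \<open>x\<close> are the eigenvalues of \<open>|A|\<^sup>2\<close> on \<open>G\<close>. The point is that
  \<open>Z \<ge> x a a\<^sup>*\<close> implies \<open>\<langle>a, Z\<^sup>-\<^sup>1 a\<rangle> \<le> 1 / x\<close>, whence \<open>\<langle>a, Z\<^sup>r\<^sup>-\<^sup>1 a\<rangle> \<le> x\<^sup>r\<^sup>-\<^sup>1\<close> by Young's inequality.\<close>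

lemma rotfeld_half:
  fixes A :: "'a::{real_inner,complete_space} \<Rightarrow>\<^sub>L 'a"
  assumes G: "orthonormal_basis G" and gram: "\<And>a v. a \<in> G \<Longrightarrow> inner (A a) (A v) = x a * inner a v"
    and F: "finite F" "orthonormal F" and z: "\<And>e. e \<in> F \<Longrightarrow> z e > 0"
    and dom: "\<And>c. (norm (A (\<Sum>e\<in>F. c e *\<^sub>R e)))\<^sup>2 \<le> (\<Sum>e\<in>F. (c e)\<^sup>2 * z e)"
    and r: "0 < r" "r \<le> 1" and s: "((\<lambda>a. x a powr r) has_sum s) G"
  shows "(\<Sum>e\<in>F. z e powr (r - 1) * (norm (A e))\<^sup>2) \<le> s"
proof (rule has_sum_mono[OF _ s])
  have "((\<lambda>a. (inner a e)\<^sup>2 * x a) has_sum (norm (A e))\<^sup>2) G" for e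
  proof -
    have "((\<lambda>a. inner (A (inner a e *\<^sub>R a)) (A e)) has_sum inner (A e) (A e)) G"
      by (intro has_sum_bounded_linear[OF bounded_linear_inner_left]
          has_sum_bounded_linear[OF blinfun.bounded_linear_right] orthonormal_basis_expansion G)
    moreover have "inner (A (inner a e *\<^sub>R a)) (A e) = (inner a e)\<^sup>2 * x a" if "a \<in> G" for a
      using gram[OF that, of e] by (simp add: blinfun.scaleR_right power2_eq_square)
    ultimately have "((\<lambda>a. (inner a e)\<^sup>2 * x a) has_sum inner (A e) (A e)) G"
      by (simp cong: has_sum_cong)
    then show ?thesis by (simp only: dot_square_norm)
  qed
  then show "((\<lambda>a. \<Sum>e\<in>F. z e powr (r - 1) * ((inner a e)\<^sup>2 * x a))
      has_sum (\<Sum>e\<in>F. z e powr (r - 1) * (norm (A e))\<^sup>2)) G"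
    by (intro has_sum_finite_sum F has_sum_cmult_right)
  fix a assume a: "a \<in> G"
  have na: "norm a = 1" using G a by (simp add: orthonormal_basis_def orthonormal_def)
  have xa: "x a = (norm (A a))\<^sup>2" using gram[OF a, of a] na by (simp add: dot_square_norm)
  show "(\<Sum>e\<in>F. z e powr (r - 1) * ((inner a e)\<^sup>2 * x a)) \<le> x a powr r"
  proof (cases "x a = 0")
    case False
    then have x0: "x a > 0" using xa by (simp add: less_le)
    define w where "w e = (inner a e)\<^sup>2" for e
    define S where "S = (\<Sum>e\<in>F. w e / z e)"
    have S0: "S \<ge> 0" unfolding S_def by (intro sum_nonneg) (auto simp: w_def intro!: divide_nonneg_pos z)
    \<comment> \<open>Z^(-1) applied to the projection of a onto the span of F, so that S stands for
      \<langle>a, Z^(-1) a\<rangle>.\<close>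
    define v where "v = (\<Sum>e\<in>F. (inner a e / z e) *\<^sub>R e)"
    have av: "inner a v = S"
      by (simp add: v_def S_def w_def inner_sum_right power2_eq_square)
    have "(norm (A v))\<^sup>2 \<le> (\<Sum>e\<in>F. (inner a e / z e)\<^sup>2 * z e)" unfolding v_def by (rule dom)
    also have "\<dots> = S"
      unfolding S_def w_def using z by (intro sum.cong) (auto simp: power2_eq_square dest!: less_imp_neq)
    finally have Av: "(norm (A v))\<^sup>2 \<le> S" .
    \<comment> \<open>Cauchy-Schwarz together with \<parallel>A v\<parallel>^2 \<le> S gives (x S)^2
      \<le> x S, hence x S \<le> 1.\<close>
    have "x a * S = inner (A a) (A v)" using gram[OF a, of v] av by simp
    also have "\<dots> \<le> norm (A a) * norm (A v)" by (rule norm_cauchy_schwarz)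
    finally have "(x a * S)\<^sup>2 \<le> (norm (A a) * norm (A v))\<^sup>2"
      using x0 S0 by (intro power_mono) auto
    also have "\<dots> \<le> x a * S" unfolding power_mult_distrib xa[symmetric] using Av x0 by simp
    finally have "(x a * S) * (x a * S) \<le> 1 * (x a * S)" by (simp add: power2_eq_square)
    then have xS: "x a * S \<le> 1" using x0 S0 by (cases "S = 0") (auto simp: mult_le_cancel_right)
    have W: "(\<Sum>e\<in>F. w e) \<le> 1"
      using bessel_finite[OF F(2,1), of a] na by (simp add: w_def inner_commute)
    have "z e powr (r - 1) * (w e * x a) \<le> x a powr r * (r * w e + (1 - r) * (x a * (w e / z e)))"
      if e: "e \<in> F" for e
    proof -
      have ze: "z e > 0" by (rule z[OF e])
      \<comment> \<open>The tangent of the power 1 - r at 1. Summed with the weights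
        \<open>w e\<close>, its two terms are controlled by Bessel and by x S \<le> 1 and add up to
        at most r + (1 - r) = 1.\<close>
      have "(x a / z e) powr (1 - r) \<le> r + (1 - r) * (x a / z e)"
      proof (cases "r = 1")
        case False
        then show ?thesis
          using young_tangent[of "x a / z e" "1 - r"] r x0 ze by (simp add: algebra_simps)
      qed (use x0 ze in simp)
      then have "(x a / z e) powr (1 - r) * (x a powr r * w e)
          \<le> (r + (1 - r) * (x a / z e)) * (x a powr r * w e)"
        by (intro mult_right_mono) (auto simp: w_def)
      moreover have "(x a / z e) powr (1 - r) * (x a powr r * w e) = z e powr (r - 1) * (w e * x a)"
      proof -
        have "(x a / z e) powr (1 - r) * x a powr r = x a * z e powr (r - 1)"
          using x0 ze powr_add[of "x a" "1 - r" r] powr_minus_divide[of "z e" "1 - r"]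
          by (simp add: powr_divide)
        then show ?thesis by (simp add: mult_ac)
      qed
      moreover have "(r + (1 - r) * (x a / z e)) * (x a powr r * w e)
          = x a powr r * (r * w e + (1 - r) * (x a * (w e / z e)))"
        by (simp add: algebra_simps)
      ultimately show ?thesis by (simp only:)
    qed
    then have "(\<Sum>e\<in>F. z e powr (r - 1) * (w e * x a))
        \<le> (\<Sum>e\<in>F. x a powr r * (r * w e + (1 - r) * (x a * (w e / z e))))"
      by (rule sum_mono)
    also have "\<dots> = x a powr r * (r * (\<Sum>e\<in>F. w e) + (1 - r) * (x a * S))"
      by (simp add: S_def sum_distrib_left sum.distrib distrib_left)
    also have "\<dots> \<le> x a powr r * (r * 1 + (1 - r) * 1)"
      using r W xS by (intro mult_left_mono add_mono) auto
    finally show ?thesis by (simp add: w_def)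
  qed simp
qed

section \<open>Excluding the pair A, B in the Schatten class\<close>

lemma schatten_no_l1_pair_ge2:
  fixes A B :: "'i op"
  assumes p: "p \<ge> 2"
    and mem: "A \<in> schatten p" "B \<in> schatten p" "A + B \<in> schatten p" "A - B \<in> schatten p"
    and n: "schatten_norm p A = 1" "schatten_norm p B = 1"
      "schatten_norm p (A + B) = 2" "schatten_norm p (A - B) = 2"
  shows False
proof -
  have p0: "p > 0" using p by simp
  have bd: "A \<in> bounded_ops" "B \<in> bounded_ops" "A - B \<in> bounded_ops"
    using mem by (auto simp: schatten_def)
  obtain G where G: "orthonormal_basis G"
    "\<And>e. e \<in> G \<Longrightarrow> adj (A + B) ((A + B) e) = (norm ((A + B) e))\<^sup>2 *\<^sub>R e"
    "\<And>e. e \<in> G \<Longrightarrow> inner e (op_powr (op_abs (A + B)) p e) = norm ((A + B) e) powr p"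
    by (rule gram_eigenbasis[OF mem(3) p0]) (rule that)
  have ne: "norm e = 1" if "e \<in> G" for e
    using G(1) that by (simp add: orthonormal_basis_def orthonormal_def)
  let ?t = "\<lambda>T e. inner e (op_powr (op_abs T) p e)"
  note tr = schatten_trace[OF _ p0 G(1)]
  \<comment> \<open>Each trace is doubled over a real basis, so the total is 2^(p-1) * 4 - 2 * 2^p =
    0: the trace of |A+B|^p alone exhausts Clarkson's bound.\<close>
  have "((\<lambda>e. 2 powr (p - 1) * (?t A e + ?t B e) + (- 1) * ?t (A + B) e) has_sum
      2 powr (p - 1) * (2 * 1 powr p + 2 * 1 powr p) + (- 1) * (2 * 2 powr p)) G"
    using tr[OF mem(1)] tr[OF mem(2)] tr[OF mem(3)] unfolding n
    by (intro has_sum_cmult_right has_sum_add)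
  moreover have "2 powr (p - 1) * (2 * 1 powr p + 2 * 1 powr p) + (- 1) * (2 * 2 powr p) = (0 :: real)"
    using powr_add[of "2 :: real" "p - 1" 1] by simp
  ultimately have "((\<lambda>e. 2 powr (p - 1) * (?t A e + ?t B e) + (- 1) * ?t (A + B) e) has_sum 0) G"
    by (simp only:)
  then have h: "((\<lambda>e. 2 powr (p - 1) * (?t A e + ?t B e) - ?t (A + B) e) has_sum 0) G"
    by simp
  \<comment> \<open>Jensen raises the terms of A and B to diagonal entries; the term of A + B is
    moved across the inequality, which is possible because it is exact on its eigenbasis.\<close>
  have le: "norm ((A - B) e) powr p \<le> 2 powr (p - 1) * (?t A e + ?t B e) - ?t (A + B) e"
    if e: "e \<in> G" for e
  proof -
    have "norm ((A + B) e) powr p + norm ((A - B) e) powr p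
        \<le> 2 powr (p - 1) * (norm (A e) powr p + norm (B e) powr p)"
      using clarkson_vector[OF p, of "A e" "B e"] by (simp add: blinfun.add_left blinfun.diff_left)
    also have "\<dots> \<le> 2 powr (p - 1) * (?t A e + ?t B e)"
      by (intro mult_left_mono add_mono op_abs_power_ge bd p ne e) simp
    finally show ?thesis using G(3)[OF e] by simp
  qed
  have zero: "(A - B) e = 0" if e: "e \<in> G" for e
  proof -
    have "2 powr (p - 1) * (?t A e + ?t B e) - ?t (A + B) e = 0"
      by (rule nonneg_has_sum_le_0D[OF h order_refl order_trans[OF powr_ge_zero le] e])
    then have "norm ((A - B) e) powr p \<le> 0" using le[OF e] by simp
    then show ?thesis using powr_ge_zero[of "norm ((A - B) e)" p] by (simp add: powr_eq_0_iff)
  qed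
  \<comment> \<open>Vanishing on the basis already makes the trace of |A-B|^p zero, against
    \<parallel>A-B\<parallel> = 2.\<close>
  have "?t (A - B) e = 0" if "e \<in> G" for e
  proof -
    have "op_powr (op_abs (A - B)) p e = (0 powr (p/2)) *\<^sub>R e"
      by (rule op_abs_power_eigenvector[OF bd(3) p0]) (simp_all add: zero[OF that])
    then show ?thesis using p0 by simp
  qed
  then have "((\<lambda>e. 0 :: real) has_sum 2 * 2 powr p) G"
    using tr[OF mem(4)] unfolding n by (simp cong: has_sum_cong)
  then have "2 * 2 powr p = (0 :: real)" by (rule has_sum_unique) (rule has_sum_0, simp)
  then show False by simp
qed

lemma schatten_no_l1_pair_le2:
  fixes A B :: "'i op"
  assumes p: "1 < p" "p \<le> 2"
    and mem: "A \<in> schatten p" "B \<in> schatten p" "A + B \<in> schatten p" "A - B \<in> schatten p"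
    and n: "schatten_norm p A = 1" "schatten_norm p B = 1"
      "schatten_norm p (A + B) = 2" "schatten_norm p (A - B) = 2"
  shows False
proof -
  have p0: "p > 0" using p by simp
  have bd: "A \<in> bounded_ops" "B \<in> bounded_ops" "A + B \<in> bounded_ops" "A - B \<in> bounded_ops"
    using mem by (auto simp: schatten_def)
  define Z where "Z = (adj A o\<^sub>L A) + (adj B o\<^sub>L B)"
  have inZ: "inner x (Z y) = inner (A x) (A y) + inner (B x) (B y)" for x y
    using inner_gram[OF bd(1), of x y] inner_gram[OF bd(2), of x y]
    by (simp add: Z_def blinfun.add_left inner_add_right)
  have "positive_op Z"
    unfolding positive_op_def using inZ by (metis add_nonneg_nonneg inner_commute inner_ge_zero)
  moreover have "compact_op Z"
    unfolding Z_def by (intro compact_op_add compact_op_compose_left schatten_compact[OF _ p0] mem)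
  ultimately obtain G where G: "orthonormal_basis G" "\<And>e. e \<in> G \<Longrightarrow> Z e = inner e (Z e) *\<^sub>R e"
    using compact_op_eigenbasis by blast
  have on: "orthonormal G" using G(1) by (simp add: orthonormal_basis_def)
  have ne: "norm e = 1" if "e \<in> G" for e
    using on that by (simp add: orthonormal_def)
  define z where "z e = (norm (A e))\<^sup>2 + (norm (B e))\<^sup>2" for e
  have Ze: "Z e = z e *\<^sub>R e" if "e \<in> G" for e
    using G(2)[OF that] by (simp add: inZ z_def dot_square_norm)
  \<comment> \<open>Dropping one of the two summands on the left gives the domination hypothesis of
    \<open>rotfeld_half\<close> for A and for B.\<close>
  have quad: "(norm (A (\<Sum>e\<in>F. c e *\<^sub>R e)))\<^sup>2 + (norm (B (\<Sum>e\<in>F. c e *\<^sub>R e)))\<^sup>2 = (\<Sum>e\<in>F. (c e)\<^sup>2 * z e)"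
    if F: "finite F" "F \<subseteq> G" for F c
  proof -
    let ?v = "\<Sum>e\<in>F. c e *\<^sub>R e"
    have "Z ?v = (\<Sum>e\<in>F. (c e * z e) *\<^sub>R e)"
      using F Ze by (auto simp: blinfun.sum_right blinfun.scaleR_right intro!: sum.cong)
    then have "inner ?v (Z ?v) = (\<Sum>e\<in>F. c e * inner e (\<Sum>e\<in>F. (c e * z e) *\<^sub>R e))"
      by (simp add: inner_sum_left)
    also have "\<dots> = (\<Sum>e\<in>F. (c e)\<^sup>2 * z e)"
      using orthonormal_inner_sum[OF on F] F by (intro sum.cong) (auto simp: power2_eq_square)
    finally show ?thesis by (simp add: inZ dot_square_norm)
  qed
  \<comment> \<open>The bound is 2 and not 1 because traces over a real basis are doubled.\<close>
  have half: "(\<Sum>e\<in>F. z e powr (p/2 - 1) * (norm (T e))\<^sup>2) \<le> 2"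
    if F: "finite F" "F \<subseteq> G" "\<And>e. e \<in> F \<Longrightarrow> z e > 0"
      and T: "T \<in> schatten p" "schatten_norm p T = 1"
      and le: "\<And>v. (norm (T v))\<^sup>2 \<le> (norm (A v))\<^sup>2 + (norm (B v))\<^sup>2" for F T
  proof -
    have bT: "T \<in> bounded_ops" using T by (auto simp: schatten_def)
    obtain H where H: "orthonormal_basis H" "\<And>e. e \<in> H \<Longrightarrow> adj T (T e) = (norm (T e))\<^sup>2 *\<^sub>R e"
      "\<And>e. e \<in> H \<Longrightarrow> inner e (op_powr (op_abs T) p e) = norm (T e) powr p"
      by (rule gram_eigenbasis[OF T(1) p0]) (rule that)
    show ?thesis
    proof (rule rotfeld_half[OF H(1) _ F(1) _ F(3)])
      show "inner (T a) (T v) = (norm (T a))\<^sup>2 * inner a v" if "a \<in> H" for a v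
        using inner_adj[OF bT, of "T a" v] H(2)[OF that] by simp
      show "orthonormal F" by (rule orthonormal_subset[OF on F(2)])
      show "(norm (T (\<Sum>e\<in>F. c e *\<^sub>R e)))\<^sup>2 \<le> (\<Sum>e\<in>F. (c e)\<^sup>2 * z e)" for c
        using le[of "\<Sum>e\<in>F. c e *\<^sub>R e"] quad[OF F(1,2), of c] by simp
      have "((\<lambda>e. norm (T e) powr p) has_sum 2) H"
        using schatten_trace[OF T(1) p0 H(1)] H(3) unfolding T(2) powr_one_eq_one mult_1_right
        by (simp cong: has_sum_cong)
      then show "((\<lambda>e. (norm (T e))\<^sup>2 powr (p/2)) has_sum 2) H"
        by (simp add: powr_square_half)
    qed (use p in auto)
  qed
  \<comment> \<open>Finite subsets suffice, so summability of \<open>z e powr (p/2)\<close> need not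
    be known beforehand.\<close>
  have zsum: "(\<Sum>e\<in>F. z e powr (p/2)) \<le> 4" if F: "finite F" "F \<subseteq> G" for F
  proof -
    \<comment> \<open>\<open>rotfeld_half\<close> divides by the eigenvalues; those equal to 0
      contribute \<open>0 powr (p/2) = 0\<close>.\<close>
    let ?F = "{e\<in>F. z e \<noteq> 0}"
    have pos: "z e > 0" if "e \<in> ?F" for e
      using that by (simp add: z_def less_le)
    have "(\<Sum>e\<in>F. z e powr (p/2)) = (\<Sum>e\<in>?F. z e powr (p/2))"
      using F(1) by (intro sum.mono_neutral_right) auto
    also have "\<dots> = (\<Sum>e\<in>?F. z e powr (p/2 - 1) * (norm (A e))\<^sup>2)
        + (\<Sum>e\<in>?F. z e powr (p/2 - 1) * (norm (B e))\<^sup>2)"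
    proof -
      have "z e powr (p/2) = z e powr (p/2 - 1) * (norm (A e))\<^sup>2 + z e powr (p/2 - 1) * (norm (B e))\<^sup>2"
        if "e \<in> ?F" for e
      proof -
        have "z e powr (p/2) = z e powr (p/2 - 1) * z e"
          using powr_add[of "z e" "p/2 - 1" 1] pos[OF that] by simp
        then show ?thesis by (simp add: z_def distrib_left)
      qed
      then show ?thesis by (simp add: sum.distrib)
    qed
    also have "\<dots> \<le> 2 + 2"
      using F pos by (intro add_mono half mem n) auto
    finally show ?thesis by simp
  qed
  let ?t = "\<lambda>T e. inner e (op_powr (op_abs T) p e)"
  note tr = schatten_trace[OF _ p0 G(1)]
  have h: "((\<lambda>e. ?t (A + B) e + ?t (A - B) e) has_sum (2 * 2 powr p + 2 * 2 powr p)) G"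
    using tr[OF mem(3)] tr[OF mem(4)] unfolding n by (rule has_sum_add)
  have "2 * 2 powr p + 2 * 2 powr p \<le> (8 :: real)"
  proof (rule has_sum_le_finite_sums[OF h])
    fix F assume F: "finite F" "F \<subseteq> G"
    have "?t (A + B) e + ?t (A - B) e \<le> 2 * z e powr (p/2)" if e: "e \<in> F" for e
    proof -
      have "?t (A + B) e + ?t (A - B) e \<le> norm ((A + B) e) powr p + norm ((A - B) e) powr p"
        using e F by (intro add_mono op_abs_power_le bd p0 p ne) auto
      also have "\<dots> \<le> 2 * z e powr (p/2)"
        using clarkson_vector_concave[OF p0 p(2), of "A e" "B e"]
        by (simp add: z_def blinfun.add_left blinfun.diff_left)
      finally show ?thesis .
    qed
    then have "(\<Sum>e\<in>F. ?t (A + B) e + ?t (A - B) e) \<le> (\<Sum>e\<in>F. 2 * z e powr (p/2))"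
      by (rule sum_mono)
    also have "\<dots> \<le> 8" using zsum[OF F] by (simp flip: sum_distrib_left)
    finally show "(\<Sum>e\<in>F. ?t (A + B) e + ?t (A - B) e) \<le> 8" .
  qed
  \<comment> \<open>Here p > 1 is decisive: the bound just proved amounts to 2^p \<le> 2.\<close>
  moreover have "(2 :: real) powr 1 < 2 powr p" using p by (intro powr_less_mono) auto
  ultimately show False by simp
qed

section \<open>Diagonal matrices in the trace class and the final contradiction\<close>

definition coord_proj :: "'i \<Rightarrow> 'i op" where
  "coord_proj i = Blinfun (\<lambda>x. coord x i *\<^sub>C basis_vec i)"

lemma cscale_add_left: "(a + b) *\<^sub>C x = a *\<^sub>C x + b *\<^sub>C x"
  by transfer (simp add: distrib_right)

lemma cscale_cscale: "a *\<^sub>C (b *\<^sub>C x) = (a * b) *\<^sub>C x"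
  by transfer (simp add: mult.assoc)

lemma coord_proj_apply: "coord_proj i x = coord x i *\<^sub>C basis_vec i"
proof -
  have "bounded_linear (\<lambda>x :: 'a ell2. coord x i *\<^sub>C basis_vec i)"
  proof (rule bounded_linear_intro[of _ 1])
    show "coord (x + y) i *\<^sub>C basis_vec i = coord x i *\<^sub>C basis_vec i + coord y i *\<^sub>C basis_vec i"
      for x y :: "'a ell2"
      by (simp add: plus_ell2.rep_eq cscale_add_left)
    show "coord (r *\<^sub>R x) i *\<^sub>C basis_vec i = r *\<^sub>R (coord x i *\<^sub>C basis_vec i)" for r and x :: "'a ell2"
      by (simp add: scaleR_ell2.rep_eq cscale_cscale cscale_of_real[symmetric, of _ "_ *\<^sub>C _"])
    have "norm (basis_vec i :: 'a ell2) = 1"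
      by (simp add: norm_eq_sqrt_inner inner_basis_vec coord_basis_vec)
    then show "norm (coord x i *\<^sub>C basis_vec i) \<le> norm x * 1" for x :: "'a ell2"
      using sum_coord_le_norm[of "{i}" x] by (simp add: norm_cscale abs_le_square_iff[symmetric])
  qed
  then show ?thesis by (simp add: coord_proj_def bounded_linear_Blinfun_apply)
qed

text \<open>Real s and t cover the preimages of A, B, A + B and A - B at once. The matrix is
  self-adjoint and diagonal, so its trace norm is the sum of the absolute values of the diagonal
  entries.\<close>

lemma schatten_norm_coord_proj:
  fixes i j :: "'m::finite" and s t :: real
  assumes ij: "i \<noteq> j"
  defines "T \<equiv> s *\<^sub>R coord_proj i + t *\<^sub>R coord_proj j"
  shows "T \<in> schatten 1" and "schatten_norm 1 T = \<bar>s\<bar> + \<bar>t\<bar>"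
proof -
  have Tx: "T x = s *\<^sub>R (coord x i *\<^sub>C basis_vec i) + t *\<^sub>R (coord x j *\<^sub>C basis_vec j)" for x
    by (simp add: T_def blinfun.add_left blinfun.scaleR_left coord_proj_apply)
  have cadd: "a *\<^sub>C (x + y) = a *\<^sub>C x + a *\<^sub>C y" and csc: "a *\<^sub>C (r *\<^sub>R x) = r *\<^sub>R (a *\<^sub>C x)"
    for a r and x y :: "'m ell2"
    using linear_simps(1,5)[OF bounded_linear_cscale[of a]] by auto
  have b: "T \<in> bounded_ops"
    by (simp add: bounded_ops_def Tx cadd csc cscale.rep_eq cscale_cscale)
  have sym: "inner (T x) y = inner x (T y)" for x y
  proof -
    have "inner (coord x k *\<^sub>C basis_vec k) y = inner x (coord y k *\<^sub>C basis_vec k)" for k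
      by (subst inner_commute)
        (simp add: inner_ell2_def cinner_scale_right cinner_commute[of _ "basis_vec k"] cinner_basis_vec
          cinner_scale_left)
    then show ?thesis by (simp add: Tx inner_add_left inner_add_right)
  qed
  have adj: "adj T = T" by (rule bounded_ops_real_adjoint[OF b sym])
  define d where "d k = (if k = i then s else if k = j then t else 0)" for k
  have one: "1 *\<^sub>C x = x" and zero: "0 *\<^sub>C x = 0" for x :: "'m ell2"
    by (transfer, simp)+
  have "T (basis_vec k) = d k *\<^sub>R basis_vec k" for k
    using ij by (auto simp: Tx d_def coord_basis_vec one zero)
  then have eig: "adj T (T (basis_vec k)) = (d k)\<^sup>2 *\<^sub>R basis_vec k" for k
    by (simp add: adj blinfun.scaleR_right power2_eq_square)
  have "op_powr (op_abs T) 1 (basis_vec k) = \<bar>d k\<bar> *\<^sub>R basis_vec k" for k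
    using op_abs_power_eigenvector[OF b _ eig, of 1 k] by (simp add: powr_half_sqrt)
  then have tr: "pos_trace (op_powr (op_abs T) 1) = ennreal (\<Sum>k\<in>UNIV. \<bar>d k\<bar>)"
    by (simp add: pos_trace_def cinner_basis_vec scaleR_ell2.rep_eq coord_basis_vec sum_ennreal)
  have "(\<Sum>k\<in>UNIV. \<bar>d k\<bar>) = (\<Sum>k\<in>{i, j}. \<bar>d k\<bar>)"
    by (intro sum.mono_neutral_right) (auto simp: d_def)
  also have "\<dots> = \<bar>s\<bar> + \<bar>t\<bar>" using ij by (simp add: d_def)
  finally have "pos_trace (op_powr (op_abs T) 1) = ennreal (\<bar>s\<bar> + \<bar>t\<bar>)"
    by (simp only: tr)
  then show "T \<in> schatten 1" "schatten_norm 1 T = \<bar>s\<bar> + \<bar>t\<bar>"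
    using b by (simp_all add: schatten_def schatten_norm_def del: ennreal_plus)
qed

theorem theorem1p3:
  fixes p :: real
  assumes "1 < p" and "CARD('m::finite) \<ge> 2"
  shows "\<not> (\<exists>J :: 'm op \<Rightarrow> nat op. schatten_isometric_embedding 1 p J)"
proof
  assume "\<exists>J :: 'm op \<Rightarrow> nat op. schatten_isometric_embedding 1 p J"
  then obtain J :: "'m op \<Rightarrow> nat op" where
    mem: "\<And>T. T \<in> schatten 1 \<Longrightarrow> J T \<in> schatten p" and
    add: "\<And>S T. S \<in> schatten 1 \<Longrightarrow> T \<in> schatten 1 \<Longrightarrow> J (S + T) = J S + J T" and
    scale: "\<And>a T. T \<in> schatten 1 \<Longrightarrow> J (op_cscale a T) = op_cscale a (J T)" and
    iso: "\<And>T. T \<in> schatten 1 \<Longrightarrow> schatten_norm p (J T) = schatten_norm 1 T"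
    unfolding schatten_isometric_embedding_def by blast
  have "\<not> is_singleton (UNIV :: 'm set)" using assms(2) by (simp add: is_singleton_altdef)
  then obtain i j :: 'm where ij: "i \<noteq> j" by (metis UNIV_I is_singletonI' UNIV_not_empty)
  let ?D = "\<lambda>s t. s *\<^sub>R coord_proj i + t *\<^sub>R coord_proj j :: 'm op"
  \<comment> \<open>Homogeneity of J is expressed through \<open>op_cscale\<close>, so differences
    are obtained from addition and the scalar -1.\<close>
  have minus: "op_cscale (-1) T = - T" for T :: "'k op"
    by (rule blinfun_eqI)
      (metis cscale_of_real of_real_1 of_real_minus op_cscale_apply scaleR_minus1_left uminus_blinfun.rep_eq)
  define A B where "A = J (?D 1 0)" and "B = J (?D 0 1)"
  have D: "?D s t \<in> schatten 1" "schatten_norm 1 (?D s t) = \<bar>s\<bar> + \<bar>t\<bar>" for s t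
    using schatten_norm_coord_proj[OF ij] by auto
  have plus: "A + B = J (?D 1 1)"
    using add[OF D(1) D(1), of 1 0 0 1] by (simp add: A_def B_def)
  have "J (?D 0 (-1)) = - B"
    using scale[OF D(1), of "-1" 0 1] by (simp add: minus B_def)
  then have diff: "A - B = J (?D 1 (-1))"
    using add[OF D(1) D(1), of 1 0 0 "-1"] by (simp add: A_def)
  have "A \<in> schatten p" "B \<in> schatten p" "A + B \<in> schatten p" "A - B \<in> schatten p"
    unfolding plus diff unfolding A_def B_def by (rule mem[OF D(1)])+
  moreover have "schatten_norm p A = 1" "schatten_norm p B = 1"
    "schatten_norm p (A + B) = 2" "schatten_norm p (A - B) = 2"
    unfolding plus diff unfolding A_def B_def iso[OF D(1)] D(2) by simp_all
  ultimately show False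
    using schatten_no_l1_pair_ge2[of p A B] schatten_no_l1_pair_le2[of p A B] assms(1)
    by (cases "p \<ge> 2") auto
qed

end
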